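(* Let $k\ge2$ be an integer. Then, as $x\to\infty$, $$\mathop{\sum\nolimits'}_{N(\alpha)\le x}{\mathfrak t}^{(e)}_k(\alpha)=C_kx+O\bigl(x^{1/2}\log^{3+4(k-1)/3}x\bigr),\qquad \mathop{\sum\nolimits'}_{N(\alpha)\le x}{\mathfrak t}^{(e)}_{k*}(\alpha)=C_{k*}x+O\bigl(x^{1/2}\log^{3+2(k^2+k-2)/3}x\bigr),$$ where $$C_k=\frac{\pi}{4}\prod_{\mathfrak p}\Bigl(1+\sum_{a=2}^\infty\frac{\tau_k(a)-\tau_k(a-1)}{N^a({\mathfrak p})}\Bigr),\qquad C_{k*}=\frac{\pi}{4}\prod_{\mathfrak p}\Bigl(1+\sum_{a=2}^\infty\frac{{\mathfrak t}_k(a)-{\mathfrak t}_k(a-1)}{N^a({\mathfrak p})}\Bigr).$$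
   Context: $\mathbb{Z}[i]$ is the ring of Gaussian integers, $N(a+bi)=a^2+b^2$. $\sum'$ denotes summation over nonzero Gaussian integers taken up to associates (one representative from each class $\{\alpha,-\alpha,i\alpha,-i\alpha\}$), and the products are over Gaussian primes ${\mathfrak p}$ taken up to associates. $\tau_k(a)$ is the number of ordered $k$-tuples of positive integers with product $a$; ${\mathfrak t}_k(a)$ is the number of ordered $k$-tuples of nonzero Gaussian integers, each taken up to associates, whose product is associated to $a$ (equivalently, ordered $k$-tuples of ideals of $\mathbb{Z}[i]$ with product $a\mathbb{Z}[i]$). ${\mathfrak t}^{(e)}_k$ and ${\mathfrak t}^{(e)}_{k*}$ are the multiplicative functions on nonzero Gaussian integers given by ${\mathfrak t}^{(e)}_k(\varepsilon{\mathfrak p}_1^{a_1}\cdots{\mathfrak p}_r^{a_r})=\prod_j\tau_k(a_j)$ and ${\mathfrak t}^{(e)}_{k*}(\varepsilon{\mathfrak p}_1^{a_1}\cdots{\mathfrak p}_r^{a_r})=\prod_j{\mathfrak t}_k(a_j)$ for a unit $\varepsilon$ and pairwise non-associated Gaussian primes ${\mathfrak p}_j$. *)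

theory Defs
  imports "HOL-Analysis.Analysis" "HOL-Library.Landau_Symbols"
begin

definition gint :: "complex \<Rightarrow> bool" where
  "gint z \<longleftrightarrow> Re z \<in> \<int> \<and> Im z \<in> \<int>"

definition gnorm :: "complex \<Rightarrow> real" where
  "gnorm z = (Re z)\<^sup>2 + (Im z)\<^sup>2"

definition gdvd :: "complex \<Rightarrow> complex \<Rightarrow> bool" where
  "gdvd a b \<longleftrightarrow> (\<exists>c. gint c \<and> b = a * c)"

definition gunit :: "complex \<Rightarrow> bool" where
  "gunit u \<longleftrightarrow> gint u \<and> gnorm u = 1"

definition gassoc :: "complex \<Rightarrow> complex \<Rightarrow> bool" where
  "gassoc a b \<longleftrightarrow> (\<exists>u. gunit u \<and> a = u * b)"

text \<open>Canonical representatives of the associate classes of nonzero Gaussian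
integers: exactly one element of each class lies in this set.\<close>
definition grep :: "complex \<Rightarrow> bool" where
  "grep z \<longleftrightarrow> gint z \<and> Re z > 0 \<and> Im z \<ge> 0"

definition gprime :: "complex \<Rightarrow> bool" where
  "gprime p \<longleftrightarrow> gint p \<and> p \<noteq> 0 \<and> \<not> gunit p \<and>
     (\<forall>a b. gint a \<and> gint b \<and> p = a * b \<longrightarrow> gunit a \<or> gunit b)"

definition gmult :: "complex \<Rightarrow> complex \<Rightarrow> nat" where
  "gmult p a = Max {n. gdvd (p ^ n) a}"

definition tau :: "nat \<Rightarrow> nat \<Rightarrow> nat" where
  "tau k a = card {xs :: nat list. length xs = k \<and> (\<forall>x\<in>set xs. x > 0) \<and> prod_list xs = a}"

definition gtau :: "nat \<Rightarrow> nat \<Rightarrow> nat" where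
  "gtau k a = card {xs :: complex list. length xs = k \<and> (\<forall>x\<in>set xs. grep x) \<and>
                     gassoc (prod_list xs) (of_nat a)}"

definition tE :: "nat \<Rightarrow> complex \<Rightarrow> nat" where
  "tE k \<alpha> = (\<Prod>p\<in>{p. grep p \<and> gprime p \<and> gdvd p \<alpha>}. tau k (gmult p \<alpha>))"

definition tEs :: "nat \<Rightarrow> complex \<Rightarrow> nat" where
  "tEs k \<alpha> = (\<Prod>p\<in>{p. grep p \<and> gprime p \<and> gdvd p \<alpha>}. gtau k (gmult p \<alpha>))"

definition euler_fac :: "(nat \<Rightarrow> nat) \<Rightarrow> complex \<Rightarrow> real" where
  "euler_fac f p = 1 + (\<Sum>a. (real (f (a + 2)) - real (f (a + 1))) / gnorm p ^ (a + 2))"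

definition euler_partial :: "(nat \<Rightarrow> nat) \<Rightarrow> real \<Rightarrow> real" where
  "euler_partial f y = (\<Prod>p\<in>{p. grep p \<and> gprime p \<and> gnorm p \<le> y}. euler_fac f p)"

definition gsum :: "(complex \<Rightarrow> nat) \<Rightarrow> real \<Rightarrow> real" where
  "gsum f x = (\<Sum>\<alpha>\<in>{\<alpha>. grep \<alpha> \<and> gnorm \<alpha> \<le> x}. real (f \<alpha>))"

end

theory Submission
  imports Defs "HOL-Library.Multiset"
begin

text \<open>
  Let \<open>f\<close> be one of the two functions and write \<open>f = 1 * g\<close>. Since \<open>f(\<pp>) = 1\<close>, the multiplicative function
  \<open>g\<close> is supported on squareful elements, and \<open>\<bar>g(\<pp>\<^sup>2)\<bar> \<le> m\<close> with \<open>m = k - 1\<close> and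
  \<open>m = (k\<^sup>2 + k - 2) / 2\<close>, respectively. The quadrant lattice point count satisfies
  \<open>\<bar>A(y) - \<pi>y/4\<bar> \<le> K min(y, \<surd>y) \<le> K y\<^bsup>1/2+\<epsilon>\<^esup>\<close> for all \<open>y > 0\<close> and \<open>0 \<le> \<epsilon> \<le> 1/2\<close>, so summing
  \<open>g(\<beta>) A(x/N\<beta>)\<close> over all \<open>\<beta>\<close> gives the main term with error at most
  \<open>K x\<^bsup>1/2+\<epsilon>\<^esup> \<Sum> \<bar>g(\<beta>)\<bar> N\<beta>\<^bsup>-1/2-\<epsilon>\<^esup>\<close>. Comparing Euler products, this Dirichlet series is
  \<open>O(\<zeta>\<^sub>K(1+2\<epsilon>)\<^sup>m) = O(\<epsilon>\<^bsup>-m\<^esup>)\<close>, and \<open>\<epsilon> = 1/log x\<close> yields \<open>O(\<surd>x log\<^sup>m x)\<close>, which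
  is stronger than the claim. Only the prime factorization and the lattice point count matter, so the
  argument is carried out for multisets of abstract primes.
\<close>

section \<open>Sums over multisets as products\<close>

text \<open>A multiset of primes stands for an integer and its counts for the exponents, so this is
  the multiplicative function with value \<open>g a\<close> at every prime power of exponent
  \<open>a\<close>. The product runs over the support and never evaluates \<open>g 0\<close>;
  extending it to a larger set of primes requires \<open>g 0 = 1\<close>.\<close>

definition mfun :: "(nat \<Rightarrow> real) \<Rightarrow> 'a multiset \<Rightarrow> real" where
  "mfun g M = (\<Prod>p\<in>set_mset M. g (count M p))"

definition mnorm :: "('a \<Rightarrow> real) \<Rightarrow> 'a multiset \<Rightarrow> real" where
  "mnorm N M = prod_mset (image_mset N M)"

lemma mfun_eq_prod:
  assumes "finite Q" "set_mset M \<subseteq> Q" "g 0 = 1"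
  shows "mfun g M = (\<Prod>p\<in>Q. g (count M p))"
  unfolding mfun_def using assms
  by (intro prod.mono_neutral_left) (auto simp: not_in_iff)

lemma mnorm_eq_prod:
  assumes "finite Q" "set_mset M \<subseteq> Q"
  shows "mnorm N M = (\<Prod>p\<in>Q. N p ^ count M p)"
  unfolding mnorm_def image_prod_mset_multiplicity using assms
  by (intro prod.mono_neutral_left) (auto simp: not_in_iff)

lemma mnorm_empty [simp]: "mnorm N {#} = 1"
  by (simp add: mnorm_def)

lemma mnorm_union: "mnorm N (A + B) = mnorm N A * mnorm N B"
  by (simp add: mnorm_def)

text \<open>A multiset over a finite set of primes is the same as its exponent vector.
  \<open>restrict\<close> puts that vector into the extensional function space \<open>PiE\<close>,
  where the distributive law of products over sums is available.\<close>

lemma bij_betw_count: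
  assumes "finite Q"
  shows "bij_betw (\<lambda>M. restrict (count M) Q)
           {M. set_mset M \<subseteq> Q \<and> (\<forall>p\<in>Q. count M p \<in> B p)} (PiE Q B)"
proof (rule bij_betw_imageI)
  show "inj_on (\<lambda>M. restrict (count M) Q) {M. set_mset M \<subseteq> Q \<and> (\<forall>p\<in>Q. count M p \<in> B p)}"
  proof (rule inj_onI, rule multiset_eqI)
    fix M M' x
    assume M: "M \<in> {M. set_mset M \<subseteq> Q \<and> (\<forall>p\<in>Q. count M p \<in> B p)}"
      and M': "M' \<in> {M. set_mset M \<subseteq> Q \<and> (\<forall>p\<in>Q. count M p \<in> B p)}"
      and eq: "restrict (count M) Q = restrict (count M') Q"
    show "count M x = count M' x"
    proof (cases "x \<in> Q")
      case True
      then show ?thesis using fun_cong[OF eq, of x] by simp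
    next
      case False
      then have "x \<notin># M" "x \<notin># M'" using M M' by auto
      then show ?thesis by (simp add: not_in_iff)
    qed
  qed
next
  show "(\<lambda>M. restrict (count M) Q) ` {M. set_mset M \<subseteq> Q \<and> (\<forall>p\<in>Q. count M p \<in> B p)} = PiE Q B"
  proof (intro equalityI subsetI)
    fix g assume g: "g \<in> PiE Q B"
    define M where "M = Abs_multiset (\<lambda>x. if x \<in> Q then g x else 0)"
    have "finite {x. (if x \<in> Q then g x else 0) > 0}"
      by (rule finite_subset[OF _ assms]) (auto split: if_splits)
    then have cM: "count M = (\<lambda>x. if x \<in> Q then g x else 0)"
      unfolding M_def by (rule count_Abs_multiset)
    have "set_mset M \<subseteq> Q"
    proof
      fix x assume "x \<in># M"
      then have "count M x > 0" by simp
      then show "x \<in> Q" by (simp add: cM split: if_splits)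
    qed
    moreover have "restrict (count M) Q = g"
      using g by (auto simp: cM restrict_def fun_eq_iff PiE_def extensional_def)
    moreover have "\<forall>p\<in>Q. count M p \<in> B p" using g by (auto simp: cM)
    ultimately show "g \<in> (\<lambda>M. restrict (count M) Q) ` {M. set_mset M \<subseteq> Q \<and> (\<forall>p\<in>Q. count M p \<in> B p)}"
      by (intro image_eqI[of _ _ M]) auto
  qed (auto simp: PiE_def)
qed

lemma finite_multisets_bounded:
  assumes "finite Q" "\<And>p. p \<in> Q \<Longrightarrow> finite (B p)"
  shows "finite {M. set_mset M \<subseteq> Q \<and> (\<forall>p\<in>Q. count M p \<in> B p)}"
  using bij_betw_finite[OF bij_betw_count[OF assms(1), of B]] assms by (simp add: finite_PiE)

lemma sum_multisets_eq_prod: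
  fixes f :: "'a \<Rightarrow> nat \<Rightarrow> 'b :: comm_semiring_1"
  assumes "finite Q" "\<And>p. p \<in> Q \<Longrightarrow> finite (B p)"
  shows "(\<Sum>M | set_mset M \<subseteq> Q \<and> (\<forall>p\<in>Q. count M p \<in> B p). \<Prod>p\<in>Q. f p (count M p))
           = (\<Prod>p\<in>Q. \<Sum>a\<in>B p. f p a)"
proof -
  have "(\<Prod>p\<in>Q. \<Sum>a\<in>B p. f p a) = (\<Sum>g\<in>PiE Q B. \<Prod>p\<in>Q. f p (g p))"
    using assms by (rule prod_sum_PiE)
  also have "\<dots> = (\<Sum>M | set_mset M \<subseteq> Q \<and> (\<forall>p\<in>Q. count M p \<in> B p).
                     \<Prod>p\<in>Q. f p (restrict (count M) Q p))"
    by (rule sum.reindex_bij_betw[OF bij_betw_count[OF assms(1)], symmetric])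
  finally show ?thesis by simp
qed

text \<open>The Euler product over finitely many primes: exponents are now unbounded, and absolute
  convergence at each prime replaces finiteness of the exponent sets.\<close>

lemma infsum_multisets_eq_prod:
  fixes f :: "'a \<Rightarrow> nat \<Rightarrow> real"
  assumes "finite Q" "\<And>p. p \<in> Q \<Longrightarrow> (\<lambda>a. norm (f p a)) summable_on UNIV"
  shows "(\<Sum>\<^sub>\<infinity>M | set_mset M \<subseteq> Q. \<Prod>p\<in>Q. f p (count M p)) = (\<Prod>p\<in>Q. \<Sum>\<^sub>\<infinity>a. f p a)"
proof -
  have "(\<Prod>p\<in>Q. \<Sum>\<^sub>\<infinity>a. f p a) = (\<Sum>\<^sub>\<infinity>g\<in>PiE Q (\<lambda>_. UNIV). \<Prod>p\<in>Q. f p (g p))"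
    using assms by (rule infsum_prod_PiE_abs[symmetric])
  also have "\<dots> = (\<Sum>\<^sub>\<infinity>M | set_mset M \<subseteq> Q \<and> (\<forall>p\<in>Q. count M p \<in> UNIV).
                     \<Prod>p\<in>Q. f p (restrict (count M) Q p))"
    by (rule infsum_reindex_bij_betw[OF bij_betw_count[OF assms(1)], symmetric])
  finally show ?thesis by simp
qed


text \<open>Every finite family of multisets over \<open>Q\<close> sits in a finite box of exponents.\<close>

lemma sum_multisets_le_prod:
  fixes f :: "'a \<Rightarrow> nat \<Rightarrow> real"
  assumes Q: "finite Q" and F: "finite F" "\<And>M. M \<in> F \<Longrightarrow> set_mset M \<subseteq> Q"
    and nn: "\<And>p a. p \<in> Q \<Longrightarrow> 0 \<le> f p a"
    and le: "\<And>p n. p \<in> Q \<Longrightarrow> (\<Sum>a\<le>n. f p a) \<le> b p"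
  shows "(\<Sum>M\<in>F. \<Prod>p\<in>Q. f p (count M p)) \<le> (\<Prod>p\<in>Q. b p)"
proof -
  \<comment> \<open>The largest exponent occurring in \<open>F\<close>; inserting 0 keeps
    \<open>Max\<close> defined when \<open>F\<close> or \<open>Q\<close> is empty.\<close>
  define n where "n = Max (insert 0 ((\<lambda>(M, p). count M p) ` (F \<times> Q)))"
  have n: "count M p \<le> n" if "M \<in> F" "p \<in> Q" for M p
    unfolding n_def using that Q F(1) by (intro Max_ge) auto
  have "(\<Sum>M\<in>F. \<Prod>p\<in>Q. f p (count M p))
          \<le> (\<Sum>M | set_mset M \<subseteq> Q \<and> (\<forall>p\<in>Q. count M p \<in> {..n}). \<Prod>p\<in>Q. f p (count M p))"
    using Q F n nn by (intro sum_mono2 finite_multisets_bounded prod_nonneg) auto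
  also have "\<dots> = (\<Prod>p\<in>Q. \<Sum>a\<in>{..n}. f p a)"
    using Q by (intro sum_multisets_eq_prod) auto
  also have "\<dots> \<le> (\<Prod>p\<in>Q. b p)"
    using nn le by (intro prod_mono) (auto intro!: sum_nonneg)
  finally show ?thesis .
qed

text \<open>Presents the divisors of \<open>M\<close> as an exponent box, so that sums over them
  factor by \<open>sum_multisets_eq_prod\<close>.\<close>

lemma submultisets_eq:
  "{D. D \<subseteq># M} = {D. set_mset D \<subseteq> set_mset M \<and> (\<forall>p\<in>set_mset M. count D p \<in> {..count M p})}"
proof (intro equalityI subsetI CollectI conjI ballI)
  fix D assume D: "D \<in> {D. set_mset D \<subseteq> set_mset M \<and> (\<forall>p\<in>set_mset M. count D p \<in> {..count M p})}"
  show "D \<subseteq># M"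
  proof (rule mset_subset_eqI)
    fix a show "count D a \<le> count M a"
      using D by (cases "a \<in># D") (auto simp: not_in_iff)
  qed
qed (auto dest: mset_subset_eqD simp: mset_subset_eq_count)

lemma finite_submultisets: "finite {D. D \<subseteq># M}"
  unfolding submultisets_eq by (intro finite_multisets_bounded) auto

text \<open>The convolution identity t = 1 * g: on the exponent box of \<open>M\<close> the divisor
  sum factors, and each prime contributes a partial sum of \<open>g\<close>.\<close>

lemma sum_submultisets:
  fixes g :: "nat \<Rightarrow> real"
  assumes "g 0 = 1" "t 0 = 1" "\<And>n. (\<Sum>a\<le>n. g a) = t n"
  shows "(\<Sum>D | D \<subseteq># M. mfun g D) = mfun t M"
proof -
  have "(\<Sum>D | D \<subseteq># M. mfun g D)
     = (\<Sum>D | set_mset D \<subseteq> set_mset M \<and> (\<forall>p\<in>set_mset M. count D p \<in> {..count M p}).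
          \<Prod>p\<in>set_mset M. g (count D p))"
    unfolding submultisets_eq[of M] using assms(1) by (auto intro!: sum.cong mfun_eq_prod)
  also have "\<dots> = (\<Prod>p\<in>set_mset M. \<Sum>a\<le>count M p. g a)"
    by (rule sum_multisets_eq_prod) auto
  also have "\<dots> = mfun t M"
    by (simp add: mfun_def assms(3))
  finally show ?thesis .
qed

text \<open>With no linear term, only the square term and a tail starting at the cube remain. Growth
  6/5 against u \<le> 5/7 leaves a geometric series of ratio 6/7 and sum 7, and 7 (6/5)^3 = 12.096
  is rounded up to 13. The value 5/7 is a rational upper bound for 1/sqrt 2.\<close>

lemma sum_power_le_local_factor:
  fixes w :: "nat \<Rightarrow> real" and u B :: real
  assumes w: "w 0 = 1" "w (Suc 0) = 0" "w 2 \<le> m" "\<And>a. 0 \<le> w a" "\<And>a. w a \<le> B * (6/5) ^ a"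
    and u: "0 \<le> u" "u \<le> 5/7"
  shows "(\<Sum>a\<le>n. w a * u ^ a) \<le> 1 + m * u ^ 2 + 13 * B * u ^ 3"
proof -
  have B: "B \<ge> 0" using w(5)[of 0] w(1) by simp
  have tail: "(\<Sum>a<n. w (Suc (Suc (Suc a))) * u ^ Suc (Suc (Suc a))) \<le> 13 * B * u ^ 3"
  proof -
    have "(\<Sum>a<n. w (Suc (Suc (Suc a))) * u ^ Suc (Suc (Suc a)))
            \<le> (\<Sum>a<n. B * (6/5) ^ 3 * u ^ 3 * (6/7) ^ a)"
    proof (rule sum_mono)
      fix a
      have "w (Suc (Suc (Suc a))) * u ^ Suc (Suc (Suc a))
              \<le> (B * (6/5) ^ Suc (Suc (Suc a))) * u ^ Suc (Suc (Suc a))"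
        using u by (intro mult_right_mono w) auto
      also have "\<dots> = B * (6/5) ^ 3 * u ^ 3 * (6/5 * u) ^ a"
        by (simp only: power_mult_distrib power_Suc numeral_3_eq_3 power_0 mult_1_right mult_ac)
      also have "\<dots> \<le> B * (6/5) ^ 3 * u ^ 3 * (6/7) ^ a"
        using u B by (intro mult_left_mono power_mono) auto
      finally show "w (Suc (Suc (Suc a))) * u ^ Suc (Suc (Suc a)) \<le> B * (6/5) ^ 3 * u ^ 3 * (6/7) ^ a" .
    qed
    also have "\<dots> = B * (6/5) ^ 3 * u ^ 3 * (\<Sum>a<n. (6/7) ^ a)"
      by (simp add: sum_distrib_left)
    also have "\<dots> \<le> B * (6/5) ^ 3 * u ^ 3 * 7"
    proof (rule mult_left_mono)
      have "(\<Sum>a<n. (6/7::real) ^ a) \<le> (\<Sum>a. (6/7) ^ a)"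
        by (rule sum_le_suminf) (auto intro: summable_geometric)
      then show "(\<Sum>a<n. (6/7::real) ^ a) \<le> 7"
        by (simp add: suminf_geometric)
    qed (use u B in auto)
    also have "\<dots> = 12.096 * (B * u ^ 3)" by (simp add: power3_eq_cube)
    also have "\<dots> \<le> 13 * (B * u ^ 3)"
      using u B by (intro mult_right_mono) auto
    finally show ?thesis by simp
  qed
  \<comment> \<open>Enlarging the range to exponents below n + 3 lets 0, 1 and 2 be split off even
    for small \<open>n\<close>.\<close>
  have "(\<Sum>a\<le>n. w a * u ^ a) \<le> (\<Sum>a<Suc (Suc (Suc n)). w a * u ^ a)"
    using w u by (intro sum_mono2) auto
  also have "\<dots> = 1 + w 2 * u ^ 2 + (\<Sum>a<n. w (Suc (Suc (Suc a))) * u ^ Suc (Suc (Suc a)))"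
    unfolding sum.lessThan_Suc_shift using w by (simp add: numeral_2_eq_2)
  also have "\<dots> \<le> 1 + m * u ^ 2 + 13 * B * u ^ 3"
    using w(3) u by (intro add_mono tail mult_right_mono) auto
  finally show ?thesis .
qed

text \<open>Bernoulli's inequality moves the coefficients into exponents. Over all primes, the
  factors with u^2 will build the m-th power of a zeta value near 1, those with u^3 a power of a
  bounded quantity.\<close>

lemma one_plus_le_powers:
  fixes u :: real
  assumes "u \<ge> 0"
  shows "1 + real m * u ^ 2 + real n * u ^ 3 \<le> (1 + u ^ 2) ^ m * (1 + u ^ 3) ^ n"
proof -
  have "1 + real m * u ^ 2 + real n * u ^ 3 \<le> (1 + real m * u ^ 2) * (1 + real n * u ^ 3)"
    using assms by (simp add: algebra_simps)
  also have "\<dots> \<le> (1 + u ^ 2) ^ m * (1 + u ^ 3) ^ n"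
  proof (intro mult_mono Bernoulli_inequality)
    show "-1 \<le> u ^ 2" "-1 \<le> u ^ 3"
      using zero_le_power[OF assms, of 2] zero_le_power[OF assms, of 3] by linarith+
  qed (use assms in auto)
  finally show ?thesis .
qed

lemma summable_bounded_growth:
  fixes g :: "nat \<Rightarrow> real"
  assumes "\<And>a. \<bar>g a\<bar> \<le> B * (6/5) ^ a" "0 \<le> u" "u \<le> 5/7"
  shows "summable (\<lambda>a. \<bar>g a * u ^ a\<bar>)"
proof (rule summable_comparison_test)
  show "summable (\<lambda>a. B * (6/7) ^ a)"
    by (intro summable_mult summable_geometric) auto
  have "norm \<bar>g a * u ^ a\<bar> \<le> B * (6/7) ^ a" for a
  proof -
    have B: "B \<ge> 0" using assms(1)[of 0] by simp
    have "\<bar>g a * u ^ a\<bar> \<le> (B * (6/5) ^ a) * u ^ a"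
      using assms by (simp add: abs_mult mult_right_mono)
    also have "\<dots> = B * (6/5 * u) ^ a" by (simp only: power_mult_distrib mult.assoc)
    also have "\<dots> \<le> B * (6/7) ^ a"
      using assms B by (intro mult_left_mono power_mono) auto
    finally show ?thesis by simp
  qed
  then show "\<exists>N. \<forall>n\<ge>N. norm \<bar>g n * u ^ n\<bar> \<le> B * (6/7) ^ n" by blast
qed

section \<open>Generalized integers\<close>

lemma power_powr_swap: "0 < x \<Longrightarrow> (x ^ n) powr s = (x powr s) ^ n" for x :: real
  by (induction n) (auto simp: powr_mult)

text \<open>Beurling's generalized integers: multisets over \<open>P\<close> with density
  \<open>c\<close> and a square-root error. Finiteness is stated separately because
  \<open>card\<close> of an infinite set is 0.\<close>

locale beurling =
  fixes P :: "'a set" and N :: "'a \<Rightarrow> real" and c C :: real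
  assumes N_ge_2: "p \<in> P \<Longrightarrow> 2 \<le> N p"
    and finite_le: "finite {M. set_mset M \<subseteq> P \<and> mnorm N M \<le> x}"
    and count_le: "0 < x \<Longrightarrow>
      \<bar>real (card {M. set_mset M \<subseteq> P \<and> mnorm N M \<le> x}) - c * x\<bar> \<le> C * sqrt x"
begin

definition counting :: "real \<Rightarrow> real" where
  "counting x = real (card {M. set_mset M \<subseteq> P \<and> mnorm N M \<le> x})"

lemma mnorm_ge_1: "set_mset M \<subseteq> P \<Longrightarrow> 1 \<le> mnorm N M"
proof (induction M)
  case empty
  then show ?case by simp
next
  case (add p M)
  then have "1 * 1 \<le> N p * mnorm N M"
    using N_ge_2[of p] mult_mono[of 1 "N p" 1 "mnorm N M"] by auto
  then show ?case by (simp add: mnorm_def)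
qed

lemma mnorm_pos: "set_mset M \<subseteq> P \<Longrightarrow> 0 < mnorm N M"
  using mnorm_ge_1[of M] by simp

lemma mnorm_powr:
  assumes "finite Q" "Q \<subseteq> P" "set_mset M \<subseteq> Q"
  shows "mnorm N M powr s = (\<Prod>p\<in>Q. (N p powr s) ^ count M p)"
proof -
  have pos: "N p > 0" if "p \<in> Q" for p
    using N_ge_2[of p] that assms(2) by auto
  have "mnorm N M powr s = (\<Prod>p\<in>Q. (N p ^ count M p) powr s)"
    unfolding mnorm_eq_prod[OF assms(1,3)]
    by (intro prod_powr_distrib)
  also have "\<dots> = (\<Prod>p\<in>Q. (N p powr s) ^ count M p)"
    using pos by (intro prod.cong refl power_powr_swap)
  finally show ?thesis .
qed

section \<open>Counting function and the zeta function near 1\<close>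

lemma C_nonneg: "C \<ge> 0"
  using count_le[of 1] by simp

lemma counting_eq_0: "x < 1 \<Longrightarrow> counting x = 0"
proof -
  assume "x < 1"
  then have "{M. set_mset M \<subseteq> P \<and> mnorm N M \<le> x} = {}"
    by (auto dest!: mnorm_ge_1)
  then show "counting x = 0" unfolding counting_def by (metis card.empty of_nat_0)
qed

text \<open>For x < 1 the count is 0 and the main term is small because the exponent is at most 1;
  for x \<ge> 1 the exponent is at least 1/2. A bound valid for all positive \<open>x\<close> allows
  summing over all multisets, including those of norm above the cutoff.\<close>

lemma counting_error:
  assumes "0 < x" "0 \<le> e" "e \<le> 1/2"
  shows "\<bar>counting x - c * x\<bar> \<le> (\<bar>c\<bar> + C) * x powr (1/2 + e)"
proof (cases "x < 1")
  case True
  have "x powr 1 \<le> x powr (1/2 + e)"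
    using True assms by (intro powr_mono') auto
  then have "\<bar>c\<bar> * x \<le> \<bar>c\<bar> * x powr (1/2 + e)"
    using assms by (intro mult_left_mono) auto
  moreover have "0 \<le> C * x powr (1/2 + e)" using C_nonneg by simp
  ultimately show ?thesis
    using counting_eq_0[OF True] assms by (simp add: abs_mult algebra_simps)
next
  case False
  have "\<bar>counting x - c * x\<bar> \<le> C * sqrt x"
    unfolding counting_def using assms by (intro count_le)
  also have "\<dots> \<le> C * x powr (1/2 + e)"
    using False assms C_nonneg
    by (intro mult_left_mono) (auto simp: powr_half_sqrt[symmetric] intro!: powr_mono)
  also have "\<dots> \<le> (\<bar>c\<bar> + C) * x powr (1/2 + e)"
    by (intro mult_right_mono) auto
  finally show ?thesis .
qed

lemma counting_le:
  assumes "1 \<le> x"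
  shows "counting x \<le> (\<bar>c\<bar> + C) * x"
proof -
  have "sqrt x \<le> x" using assms by (intro real_le_lsqrt) (auto simp: power2_eq_square)
  then have "C * sqrt x \<le> C * x" using C_nonneg by (intro mult_left_mono)
  moreover have "\<bar>counting x - c * x\<bar> \<le> C * sqrt x"
    unfolding counting_def using assms by (intro count_le) auto
  moreover have "c * x \<le> \<bar>c\<bar> * x" using assms by (intro mult_right_mono) auto
  ultimately show ?thesis by (simp add: algebra_simps)
qed

text \<open>Bounds the geometric series in \<open>sum_powr_le\<close>. It follows from 2^d \<ge> 1 +
  d/2 and (1 - d/4)(1 + d/2) \<ge> 1.\<close>

lemma one_minus_two_powr:
  fixes d :: real
  assumes "0 < d" "d \<le> 1"
  shows "d / 4 \<le> 1 - 2 powr (-d)"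
proof -
  have "(1 - d / 4) * 2 powr d \<ge> (1 - d / 4) * (1 + d / 2)"
  proof (rule mult_left_mono)
    have "d / 2 \<le> d * ln 2" using assms ln2_ge_two_thirds by simp
    then have "1 + d / 2 \<le> 1 + d * ln 2" by simp
    also have "\<dots> \<le> exp (d * ln 2)" by (rule exp_ge_add_one_self)
    finally show "1 + d / 2 \<le> 2 powr d" by (simp add: powr_def)
  qed (use assms in auto)
  moreover have "(1 - d / 4) * (1 + d / 2) = 1 + d / 8 * (2 - d)" by (simp add: field_simps)
  moreover have "d / 8 * (2 - d) \<ge> 0" using assms by simp
  ultimately have "1 \<le> (1 - d / 4) * 2 powr d" by linarith
  then have "2 powr (-d) \<le> 1 - d / 4"
    by (simp add: powr_minus field_simps)
  then show ?thesis by simp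
qed

text \<open>Plays the role of the simple pole of zeta: zeta(1 + d) = O(1/d). Multisets are grouped
  by dyadic size of the norm; block \<open>i\<close> contributes at most 2 K 2^(-d i), and the
  resulting geometric series is at most 4/d.\<close>

lemma sum_powr_le:
  assumes F: "finite F" "\<And>M. M \<in> F \<Longrightarrow> set_mset M \<subseteq> P" and d: "0 < d" "d \<le> 1"
  shows "(\<Sum>M\<in>F. mnorm N M powr (-(1 + d))) \<le> 8 * (\<bar>c\<bar> + C) / d"
proof -
  define K where "K = \<bar>c\<bar> + C"
  have K: "K \<ge> 0" unfolding K_def using C_nonneg by simp
  \<comment> \<open>Index of the dyadic block containing the norm.\<close>
  define j where "j M = nat \<lfloor>log 2 (mnorm N M)\<rfloor>" for M
  have j: "2 ^ j M \<le> mnorm N M" "mnorm N M \<le> 2 ^ Suc (j M)" if "M \<in> F" for M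
  proof -
    have n: "1 \<le> mnorm N M" using F(2)[OF that] by (rule mnorm_ge_1)
    then have l: "0 \<le> log 2 (mnorm N M)" by simp
    have "real (j M) \<le> log 2 (mnorm N M)" "log 2 (mnorm N M) \<le> real (Suc (j M))"
      unfolding j_def using l by linarith+
    then show "2 ^ j M \<le> mnorm N M" "mnorm N M \<le> 2 ^ Suc (j M)"
      using n by (simp_all add: le_log_iff log_le_iff powr_realpow del: power_Suc of_nat_Suc)
  qed
  define J where "J = Suc (Max (insert 0 (j ` F)))"
  have J: "j M < J" if "M \<in> F" for M
    unfolding J_def less_Suc_eq_le using F(1) that by (intro Max_ge) auto
  define q where "q = 2 powr (-d)"
  have q: "0 < q" "d / 4 \<le> 1 - q" using one_minus_two_powr[OF d] by (auto simp: q_def)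
  have "(\<Sum>M\<in>F. mnorm N M powr (-(1 + d)))
      = (\<Sum>i<J. \<Sum>M\<in>{M \<in> F. j M = i}. mnorm N M powr (-(1 + d)))"
    using F(1) J by (intro sum.group[symmetric]) auto
  also have "\<dots> \<le> (\<Sum>i<J. 2 * K * q ^ i)"
  proof (rule sum_mono)
    fix i
    have "(\<Sum>M\<in>{M \<in> F. j M = i}. mnorm N M powr (-(1 + d)))
        \<le> (\<Sum>M\<in>{M \<in> F. j M = i}. (2 ^ i) powr (-(1 + d)))"
      using j d by (intro sum_mono powr_mono2') auto
    also have "\<dots> = real (card {M \<in> F. j M = i}) * (2 ^ i) powr (-(1 + d))" by simp
    also have "\<dots> \<le> (K * 2 ^ Suc i) * (2 ^ i) powr (-(1 + d))"
    proof (rule mult_right_mono)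
      have "real (card {M \<in> F. j M = i}) \<le> counting (2 ^ Suc i)"
        unfolding counting_def of_nat_le_iff using F(2) j
        by (intro card_mono finite_le) auto
      also have "\<dots> \<le> K * 2 ^ Suc i"
        unfolding K_def by (rule counting_le) (simp add: one_le_power del: power_Suc)
      finally show "real (card {M \<in> F. j M = i}) \<le> K * 2 ^ Suc i" .
    qed auto
    also have "(2 ^ i) powr (-(1 + d)) = (1/2) ^ i * q ^ i"
    proof -
      have "(2 ^ i) powr (-(1 + d)) = (2 powr (-(1 + d))) ^ i"
        by (rule power_powr_swap) simp
      also have "2 powr (-(1 + d)) = (1/2) * q"
        unfolding q_def by (simp add: powr_diff powr_minus_divide)
      finally show ?thesis by (simp only: power_mult_distrib)
    qed
    also have "(K * 2 ^ Suc i) * ((1/2) ^ i * q ^ i) = 2 * K * q ^ i"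
      by (simp add: power_one_over)
    finally show "(\<Sum>M\<in>{M \<in> F. j M = i}. mnorm N M powr (-(1 + d))) \<le> 2 * K * q ^ i" .
  qed
  also have "\<dots> = 2 * K * (\<Sum>i<J. q ^ i)" by (simp add: sum_distrib_left)
  also have "\<dots> \<le> 2 * K * (4 / d)"
  proof (rule mult_left_mono)
    have q1: "q < 1" using q d by simp
    have "(\<Sum>i<J. q ^ i) \<le> (\<Sum>i. q ^ i)"
      using q q1 by (intro sum_le_suminf summable_geometric) auto
    also have "\<dots> = 1 / (1 - q)" using q q1 by (simp add: suminf_geometric)
    also have "\<dots> \<le> 1 / (d / 4)" using q d by (intro divide_left_mono) auto
    finally show "(\<Sum>i<J. q ^ i) \<le> 4 / d" by simp
  qed (use K in auto)
  finally show ?thesis by (simp add: K_def)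
qed

text \<open>Expanding the product gives the squarefree multisets over \<open>Q\<close>, exponents 0
  and 1, hence a finite part of the zeta series.\<close>

lemma prod_one_plus_powr_le:
  assumes Q: "finite Q" "Q \<subseteq> P" and d: "0 < d" "d \<le> 1"
  shows "(\<Prod>p\<in>Q. 1 + N p powr (-(1 + d))) \<le> 8 * (\<bar>c\<bar> + C) / d"
proof -
  let ?F = "{M. set_mset M \<subseteq> Q \<and> (\<forall>p\<in>Q. count M p \<in> {..1})}"
  have "(\<Prod>p\<in>Q. 1 + N p powr (-(1 + d))) = (\<Prod>p\<in>Q. \<Sum>a\<in>{..1}. (N p powr (-(1 + d))) ^ a)"
    by simp
  also have "\<dots> = (\<Sum>M\<in>?F. \<Prod>p\<in>Q. (N p powr (-(1 + d))) ^ count M p)"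
    using Q by (intro sum_multisets_eq_prod[symmetric]) auto
  also have "\<dots> = (\<Sum>M\<in>?F. mnorm N M powr (-(1 + d)))"
    using Q by (intro sum.cong refl mnorm_powr[symmetric]) auto
  also have "\<dots> \<le> 8 * (\<bar>c\<bar> + C) / d"
    using Q d by (intro sum_powr_le finite_multisets_bounded) auto
  finally show ?thesis .
qed

end

section \<open>Multiplicative functions supported on squareful elements\<close>

lemma two_powr_half: "2 powr (-(1/2)) \<le> (5/7::real)"
proof -
  have "7/5 \<le> sqrt (2::real)" by (rule real_le_rsqrt) (simp add: power2_eq_square)
  then show ?thesis
    by (simp add: powr_minus powr_half_sqrt field_simps)
qed

text \<open>Here \<open>g\<close> is the convolution quotient of the studied function by 1. The
  condition at exponent 1 makes it squareful, \<open>m\<close> will become the power of the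
  logarithm, and the growth bound makes each local series converge at norm exponent 1/2.\<close>

locale beurling_mult = beurling +
  fixes g :: "nat \<Rightarrow> real" and m :: nat and B :: real
  assumes g0: "g 0 = 1" and g1: "g (Suc 0) = 0" and g2: "\<bar>g 2\<bar> \<le> real m"
    and g_le: "\<bar>g a\<bar> \<le> B * (6/5) ^ a"
begin

lemma B_nonneg: "B \<ge> 0"
  using g_le[of 0] by simp

lemma N_powr_le: "p \<in> P \<Longrightarrow> s \<ge> 1/2 \<Longrightarrow> N p powr (-s) \<le> 5/7"
proof -
  assume "p \<in> P" "s \<ge> 1/2"
  then have "N p powr (-s) \<le> 2 powr (-s)"
    using N_ge_2[of p] by (intro powr_mono2') auto
  also have "\<dots> \<le> 2 powr (-(1/2))"
    using \<open>s \<ge> 1/2\<close> by (intro powr_mono) auto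
  finally show "N p powr (-s) \<le> 5/7" using two_powr_half by linarith
qed

text \<open>Apply the local estimate with u = N(p)^(-1/2-e). Then u^2 has exponent 1 + 2e, and the
  exponent 3/2 + 3e of u^3 is relaxed to 1 + 1/2, so that \<open>prod_one_plus_powr_le\<close>
  covers the first with d = 2e and the second with d = 1/2.\<close>

lemma local_sum_le:
  assumes "p \<in> P" "0 < e"
  shows "(\<Sum>a\<le>n. \<bar>g a\<bar> * (N p powr (-(1/2 + e))) ^ a)
    \<le> (1 + N p powr (-(1 + 2*e))) ^ m * (1 + N p powr (-(1 + 1/2))) ^ nat \<lceil>13 * B\<rceil>"
proof -
  define u where "u = N p powr (-(1/2 + e))"
  have N: "N p \<ge> 2" using N_ge_2 assms by auto
  have u: "0 \<le> u" "u \<le> 5/7"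
    unfolding u_def using assms N_powr_le[of p "1/2 + e"] by auto
  have "(\<Sum>a\<le>n. \<bar>g a\<bar> * u ^ a) \<le> 1 + real m * u ^ 2 + 13 * B * u ^ 3"
    using g0 g1 g2 g_le u by (intro sum_power_le_local_factor) auto
  also have "\<dots> \<le> 1 + real m * u ^ 2 + real (nat \<lceil>13 * B\<rceil>) * u ^ 3"
    using u B_nonneg by (intro add_left_mono mult_right_mono) auto
  also have "\<dots> \<le> (1 + u ^ 2) ^ m * (1 + u ^ 3) ^ nat \<lceil>13 * B\<rceil>"
    using u by (intro one_plus_le_powers)
  also have "\<dots> \<le> (1 + N p powr (-(1 + 2*e))) ^ m * (1 + N p powr (-(1 + 1/2))) ^ nat \<lceil>13 * B\<rceil>"
  proof (intro mult_mono power_mono add_left_mono)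
    show "u ^ 2 \<le> N p powr (-(1 + 2*e))"
      unfolding u_def using N by (simp add: powr_power algebra_simps)
    have "u ^ 3 = N p powr (-(3/2 + 3*e))"
      unfolding u_def using N by (simp add: powr_power algebra_simps)
    also have "\<dots> \<le> N p powr (-(1 + 1/2))"
      using N assms by (intro powr_mono) auto
    finally show "u ^ 3 \<le> N p powr (-(1 + 1/2))" .
  qed (use u in auto)
  finally show ?thesis unfolding u_def .
qed

text \<open>The two bases are the zeta bound 8 K / d at d = 2e, with 1/e removed, and at d = 1/2,
  where K is \<open>\<bar>c\<bar> + C\<close>.\<close>

definition error_const :: real where
  "error_const = (4 * (\<bar>c\<bar> + C)) ^ m * (16 * (\<bar>c\<bar> + C)) ^ nat \<lceil>13 * B\<rceil>"

text \<open>Only the finite set \<open>Q\<close> of primes occurring in \<open>F\<close> matters,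
  and the Euler product over \<open>Q\<close> is bounded uniformly in \<open>Q\<close>. Independence
  of \<open>F\<close> is what gives absolute summability and permits passing to the limit.\<close>

lemma sum_abs_mfun_le:
  assumes F: "finite F" "\<And>M. M \<in> F \<Longrightarrow> set_mset M \<subseteq> P" and e: "0 < e" "e \<le> 1/2"
  shows "(\<Sum>M\<in>F. \<bar>mfun g M\<bar> * mnorm N M powr (-(1/2 + e))) \<le> error_const / e ^ m"
proof -
  define Q where "Q = (\<Union>M\<in>F. set_mset M)"
  have Q: "finite Q" "Q \<subseteq> P" "\<And>M. M \<in> F \<Longrightarrow> set_mset M \<subseteq> Q"
    unfolding Q_def using F by auto
  have "(\<Sum>M\<in>F. \<bar>mfun g M\<bar> * mnorm N M powr (-(1/2 + e)))
      = (\<Sum>M\<in>F. \<Prod>p\<in>Q. \<bar>g (count M p)\<bar> * (N p powr (-(1/2 + e))) ^ count M p)"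
    using Q g0 by (intro sum.cong refl)
      (simp only: mfun_eq_prod[of Q] mnorm_powr[of Q] abs_prod prod.distrib)
  also have "\<dots> \<le> (\<Prod>p\<in>Q. (1 + N p powr (-(1 + 2*e))) ^ m * (1 + N p powr (-(1 + 1/2))) ^ nat \<lceil>13 * B\<rceil>)"
    using Q F e
    by (intro sum_multisets_le_prod[where f = "\<lambda>p a. \<bar>g a\<bar> * (N p powr (-(1/2 + e))) ^ a"] local_sum_le) auto
  also have "\<dots> = (\<Prod>p\<in>Q. 1 + N p powr (-(1 + 2*e))) ^ m * (\<Prod>p\<in>Q. 1 + N p powr (-(1 + 1/2))) ^ nat \<lceil>13 * B\<rceil>"
    by (simp add: prod.distrib prod_power_distrib)
  also have "\<dots> \<le> (8 * (\<bar>c\<bar> + C) / (2 * e)) ^ m * (8 * (\<bar>c\<bar> + C) / (1/2)) ^ nat \<lceil>13 * B\<rceil>"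
    using Q e C_nonneg by (intro mult_mono power_mono prod_one_plus_powr_le prod_nonneg zero_le_power) auto
  also have "8 * (\<bar>c\<bar> + C) / (2 * e) = 4 * (\<bar>c\<bar> + C) / e" using e by (simp add: field_simps)
  also have "8 * (\<bar>c\<bar> + C) / (1/2) = 16 * (\<bar>c\<bar> + C)" by simp
  also have "(4 * (\<bar>c\<bar> + C) / e) ^ m * (16 * (\<bar>c\<bar> + C)) ^ nat \<lceil>13 * B\<rceil> = error_const / e ^ m"
    by (simp only: error_const_def power_divide times_divide_eq_left)
  finally show ?thesis .
qed

text \<open>The case e = 1/2 of \<open>sum_abs_mfun_le\<close>, where the norm exponent becomes
  1.\<close>

lemma summable_mfun:
  "(\<lambda>M. \<bar>mfun g M\<bar> / mnorm N M) summable_on {M. set_mset M \<subseteq> P}"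
proof (rule nonneg_bdd_above_summable_on)
  show "bdd_above (sum (\<lambda>M. \<bar>mfun g M\<bar> / mnorm N M) ` {F. F \<subseteq> {M. set_mset M \<subseteq> P} \<and> finite F})"
  proof (rule bdd_aboveI2)
    fix F assume F: "F \<in> {F. F \<subseteq> {M. set_mset M \<subseteq> P} \<and> finite F}"
    have "(\<Sum>M\<in>F. \<bar>mfun g M\<bar> / mnorm N M) = (\<Sum>M\<in>F. \<bar>mfun g M\<bar> * mnorm N M powr (-(1/2 + 1/2)))"
    proof (rule sum.cong)
      fix M assume "M \<in> F"
      then have "mnorm N M > 0" using F by (intro mnorm_pos) auto
      then show "\<bar>mfun g M\<bar> / mnorm N M = \<bar>mfun g M\<bar> * mnorm N M powr (-(1/2 + 1/2))"
        by (simp add: powr_neg_one)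
    qed simp
    also have "\<dots> \<le> error_const / (1/2) ^ m"
      using F by (intro sum_abs_mfun_le) auto
    finally show "(\<Sum>M\<in>F. \<bar>mfun g M\<bar> / mnorm N M) \<le> error_const / (1/2) ^ m" .
  qed
qed (auto dest!: mnorm_pos)

lemma summable_mfun_div:
  assumes "X \<subseteq> {M. set_mset M \<subseteq> P}"
  shows "(\<lambda>M. mfun g M / mnorm N M) summable_on X"
proof -
  have "(\<lambda>M. norm (mfun g M / mnorm N M)) summable_on {M. set_mset M \<subseteq> P}"
    using summable_mfun
    by (rule summable_on_cong[THEN iffD1, rotated]) (auto simp: abs_divide dest!: mnorm_pos)
  then have "(\<lambda>M. mfun g M / mnorm N M) summable_on {M. set_mset M \<subseteq> P}"
    by (rule abs_summable_summable)
  then show ?thesis using assms by (rule summable_on_subset_banach)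
qed

section \<open>The mean value as an Euler product\<close>

definition mean_value :: real where
  "mean_value = (\<Sum>\<^sub>\<infinity>M | set_mset M \<subseteq> P. mfun g M / mnorm N M)"

text \<open>Over finitely many primes the sum factors exactly. Exponents 0 and 1 contribute 1 and 0,
  so the remaining series starts at exponent 2, as in \<open>euler_fac\<close>.\<close>

lemma infsum_local_factor:
  assumes Q: "finite Q" "Q \<subseteq> P"
  shows "(\<Sum>\<^sub>\<infinity>M | set_mset M \<subseteq> Q. mfun g M / mnorm N M)
    = (\<Prod>p\<in>Q. 1 + (\<Sum>a. g (a + 2) / N p ^ (a + 2)))"
proof -
  have summ: "summable (\<lambda>a. \<bar>g a / N p ^ a\<bar>)" if "p \<in> Q" for p
  proof -
    have "2 \<le> N p" using N_ge_2 that Q by auto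
    then have "summable (\<lambda>a. \<bar>g a * (1 / N p) ^ a\<bar>)"
      by (intro summable_bounded_growth[OF g_le]) (auto simp: field_simps)
    then show ?thesis by (simp add: power_one_over)
  qed
  have "(\<Sum>\<^sub>\<infinity>M | set_mset M \<subseteq> Q. mfun g M / mnorm N M)
      = (\<Sum>\<^sub>\<infinity>M | set_mset M \<subseteq> Q. \<Prod>p\<in>Q. g (count M p) / N p ^ count M p)"
    using Q(1) g0 by (intro infsum_cong) (simp add: mfun_eq_prod[of Q] mnorm_eq_prod[of Q] prod_dividef)
  also have "\<dots> = (\<Prod>p\<in>Q. \<Sum>\<^sub>\<infinity>a. g a / N p ^ a)"
    using Q(1) summ by (intro infsum_multisets_eq_prod[where f = "\<lambda>p a. g a / N p ^ a"]
        norm_summable_imp_summable_on) auto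
  also have "\<dots> = (\<Prod>p\<in>Q. 1 + (\<Sum>a. g (a + 2) / N p ^ (a + 2)))"
  proof (rule prod.cong)
    fix p assume p: "p \<in> Q"
    have s: "summable (\<lambda>a. g a / N p ^ a)"
      using summ[OF p] by (rule summable_rabs_cancel)
    have "((\<lambda>a. g a / N p ^ a) has_sum (\<Sum>a. g a / N p ^ a)) UNIV"
      using summ[OF p] s by (intro norm_summable_imp_has_sum) (auto simp: summable_sums)
    then have "(\<Sum>\<^sub>\<infinity>a. g a / N p ^ a) = (\<Sum>a. g a / N p ^ a)" by (rule infsumI)
    also have "\<dots> = (\<Sum>a. g (a + 2) / N p ^ (a + 2)) + (\<Sum>a<2. g a / N p ^ a)"
      using s by (rule suminf_split_initial_segment)
    also have "(\<Sum>a<2. g a / N p ^ a) = 1"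
      using g0 g1 by (simp add: numeral_2_eq_2)
    finally show "(\<Sum>\<^sub>\<infinity>a. g a / N p ^ a) = 1 + (\<Sum>a. g (a + 2) / N p ^ (a + 2))" by simp
  qed simp
  finally show ?thesis .
qed

lemma finite_primes_le: "finite {p \<in> P. N p \<le> y}"
proof -
  have "(\<lambda>p. {#p#}) ` {p \<in> P. N p \<le> y} \<subseteq> {M. set_mset M \<subseteq> P \<and> mnorm N M \<le> y}"
    by (auto simp: mnorm_def)
  then have "finite ((\<lambda>p. {#p#}) ` {p \<in> P. N p \<le> y})"
    using finite_le by (rule finite_subset)
  then show ?thesis by (rule finite_imageD) (auto simp: inj_on_def)
qed

text \<open>The product up to \<open>y\<close> is the sum over multisets whose primes all have norm
  at most \<open>y\<close>. For large \<open>y\<close> these include any prescribed finite family,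
  so unconditional summability yields convergence.\<close>

lemma euler_product_tendsto:
  "((\<lambda>y. \<Prod>p | p \<in> P \<and> N p \<le> y. 1 + (\<Sum>a. g (a + 2) / N p ^ (a + 2))) \<longlongrightarrow> mean_value) at_top"
proof (rule tendstoI)
  fix e :: real assume "e > 0"
  let ?f = "\<lambda>M. mfun g M / mnorm N M"
  have "(?f has_sum mean_value) {M. set_mset M \<subseteq> P}"
    unfolding mean_value_def by (intro has_sum_infsum summable_mfun_div) simp
  then have "eventually (\<lambda>F. dist (sum ?f F) mean_value < e / 2) (finite_subsets_at_top {M. set_mset M \<subseteq> P})"
    unfolding has_sum_def using \<open>e > 0\<close> by (intro tendstoD) auto
  then obtain F0 where F0: "finite F0" "F0 \<subseteq> {M. set_mset M \<subseteq> P}"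
    and close: "\<forall>F. finite F \<and> F0 \<subseteq> F \<and> F \<subseteq> {M. set_mset M \<subseteq> P} \<longrightarrow> dist (sum ?f F) mean_value < e / 2"
    unfolding eventually_finite_subsets_at_top by (elim exE conjE)
  \<comment> \<open>Beyond the largest prime norm occurring in \<open>F0\<close>, every member of
    \<open>F0\<close> is composed of primes counted by the product.\<close>
  define Y where "Y = Max (insert 0 (N ` (\<Union>M\<in>F0. set_mset M)))"
  have Y: "N p \<le> Y" if "M \<in> F0" "p \<in># M" for M p
    unfolding Y_def using that F0(1) by (intro Max_ge) auto
  show "eventually (\<lambda>y. dist (\<Prod>p | p \<in> P \<and> N p \<le> y. 1 + (\<Sum>a. g (a + 2) / N p ^ (a + 2))) mean_value < e) at_top"
    using eventually_ge_at_top[of Y]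
  proof eventually_elim
    fix y assume y: "Y \<le> y"
    define Q where "Q = {p. p \<in> P \<and> N p \<le> y}"
    have Q: "finite Q" "Q \<subseteq> P" unfolding Q_def using finite_primes_le[of y] by auto
    have F0Q: "F0 \<subseteq> {M. set_mset M \<subseteq> Q}"
    proof (intro subsetI CollectI)
      fix M p assume "M \<in> F0" "p \<in># M"
      then show "p \<in> Q" unfolding Q_def using F0(2) Y[of M p] y by auto
    qed
    have "(?f has_sum (\<Sum>\<^sub>\<infinity>M | set_mset M \<subseteq> Q. ?f M)) {M. set_mset M \<subseteq> Q}"
      using Q by (intro has_sum_infsum summable_mfun_div) auto
    then have lim: "(sum ?f \<longlongrightarrow> (\<Sum>\<^sub>\<infinity>M | set_mset M \<subseteq> Q. ?f M)) (finite_subsets_at_top {M. set_mset M \<subseteq> Q})"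
      by (simp add: has_sum_def)
    \<comment> \<open>Limits preserve only the weak inequality; the slack between e/2 and e restores
      the strict one.\<close>
    have "eventually (\<lambda>F. dist (sum ?f F) mean_value \<le> e / 2) (finite_subsets_at_top {M. set_mset M \<subseteq> Q})"
      unfolding eventually_finite_subsets_at_top
    proof (intro exI[of _ F0] conjI allI impI)
      fix F assume "finite F \<and> F0 \<subseteq> F \<and> F \<subseteq> {M. set_mset M \<subseteq> Q}"
      then have "finite F \<and> F0 \<subseteq> F \<and> F \<subseteq> {M. set_mset M \<subseteq> P}" using Q(2) by auto
      then show "dist (sum ?f F) mean_value \<le> e / 2" using close by (simp add: less_imp_le)
    qed (use F0 F0Q in auto)
    then have "dist (\<Sum>\<^sub>\<infinity>M | set_mset M \<subseteq> Q. ?f M) mean_value \<le> e / 2"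
      by (intro tendsto_upperbound[OF tendsto_dist[OF lim tendsto_const]]) auto
    then show "dist (\<Prod>p | p \<in> P \<and> N p \<le> y. 1 + (\<Sum>a. g (a + 2) / N p ^ (a + 2))) mean_value < e"
      using infsum_local_factor[OF Q] \<open>e > 0\<close> by (simp add: Q_def)
  qed
qed

text \<open>Insert t = 1 * g, write M = D + E and exchange the order: for fixed \<open>D\<close> the
  cofactors \<open>E\<close> are counted by \<open>counting\<close>.\<close>

lemma sum_mfun_convolution:
  assumes t: "t 0 = 1" "\<And>n. (\<Sum>a\<le>n. g a) = t n"
  shows "(\<Sum>M | set_mset M \<subseteq> P \<and> mnorm N M \<le> x. mfun t M)
    = (\<Sum>M | set_mset M \<subseteq> P \<and> mnorm N M \<le> x. mfun g M * counting (x / mnorm N M))"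
proof -
  let ?X = "\<lambda>x. {M. set_mset M \<subseteq> P \<and> mnorm N M \<le> x}"
  have "(\<Sum>M\<in>?X x. mfun t M) = (\<Sum>M\<in>?X x. \<Sum>D | D \<subseteq># M. mfun g D)"
    by (simp add: sum_submultisets[OF g0 t])
  also have "\<dots> = (\<Sum>(M, D)\<in>(SIGMA M:?X x. {D. D \<subseteq># M}). mfun g D)"
    using finite_le finite_submultisets by (intro sum.Sigma) auto
  also have "\<dots> = (\<Sum>(D, E)\<in>(SIGMA D:?X x. ?X (x / mnorm N D)). mfun g D)"
  proof (rule sum.reindex_bij_witness[of _ "\<lambda>(D, E). (D + E, D)" "\<lambda>(M, D). (D, M - D)"], goal_cases)
    case (2 MD)
    obtain M D where MD: "MD = (M, D)" "set_mset M \<subseteq> P" "mnorm N M \<le> x" "D \<subseteq># M"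
      using 2 by auto
    define E where "E = M - D"
    have M: "M = D + E" using MD by (simp add: E_def)
    have DE: "set_mset D \<subseteq> P" "set_mset E \<subseteq> P" "mnorm N D * mnorm N E \<le> x"
      using MD(2,3) by (auto simp: M mnorm_union)
    have pos: "mnorm N D > 0" using DE mnorm_pos by auto
    \<comment> \<open>Norms are at least 1, so a divisor of an element of norm at most
      \<open>x\<close> stays in the outer range.\<close>
    have "mnorm N D * 1 \<le> mnorm N D * mnorm N E"
      using DE pos mnorm_ge_1 by (intro mult_left_mono) auto
    then have "mnorm N D \<le> x" using DE by simp
    moreover have "mnorm N E \<le> x / mnorm N D" using DE pos by (simp add: field_simps)
    ultimately show ?case using DE by (simp add: MD(1) E_def[symmetric])
  next
    case (4 DE)
    obtain D E where DE: "DE = (D, E)" "set_mset D \<subseteq> P" "set_mset E \<subseteq> P" "mnorm N E \<le> x / mnorm N D"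
      using 4 by auto
    then show ?case using mnorm_pos[of D] by (auto simp: mnorm_union field_simps)
  qed auto
  also have "\<dots> = (\<Sum>D\<in>?X x. \<Sum>E\<in>?X (x / mnorm N D). mfun g D)"
    using finite_le by (intro sum.Sigma[symmetric]) auto
  also have "\<dots> = (\<Sum>D\<in>?X x. mfun g D * counting (x / mnorm N D))"
    by (simp add: counting_def mult.commute)
  finally show ?thesis .
qed

text \<open>Both the error of each count and the tail of the series for \<open>mean_value\<close>
  are handled at once: the estimate is proved with the series cut to any finite \<open>F\<close>
  containing all norms up to \<open>x\<close>, uniformly in \<open>F\<close>, and then
  \<open>F\<close> grows.\<close>

lemma sum_mfun_error:
  assumes t: "t 0 = 1" "\<And>n. (\<Sum>a\<le>n. g a) = t n" and x: "0 < x" and e: "0 < e" "e \<le> 1/2"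
  shows "\<bar>(\<Sum>M | set_mset M \<subseteq> P \<and> mnorm N M \<le> x. mfun t M) - c * mean_value * x\<bar>
    \<le> (\<bar>c\<bar> + C) * error_const * x powr (1/2 + e) / e ^ m"
proof -
  let ?I = "{M. set_mset M \<subseteq> P}"
  let ?X = "{M. set_mset M \<subseteq> P \<and> mnorm N M \<le> x}"
  let ?f = "\<lambda>M. mfun g M / mnorm N M"
  define T where "T = (\<Sum>M\<in>?X. mfun t M)"
  have T: "T = (\<Sum>M\<in>?X. mfun g M * counting (x / mnorm N M))"
    unfolding T_def using t by (rule sum_mfun_convolution)
  have bound: "\<bar>T - c * x * sum ?f F\<bar> \<le> (\<bar>c\<bar> + C) * error_const * x powr (1/2 + e) / e ^ m"
    if F: "finite F" "?X \<subseteq> F" "F \<subseteq> ?I" for F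
  proof -
    have I: "set_mset M \<subseteq> P" if "M \<in> F" for M using subsetD[OF F(3) that] by simp
    \<comment> \<open>Elements of norm above \<open>x\<close> may be added freely, since
      \<open>counting\<close> vanishes below 1.\<close>
    have "T = (\<Sum>M\<in>F. mfun g M * counting (x / mnorm N M))"
      unfolding T
    proof (rule sum.mono_neutral_left[OF F(1,2)], rule ballI)
      fix M assume "M \<in> F - ?X"
      then have M: "set_mset M \<subseteq> P" "x < mnorm N M" using I[of M] by simp_all
      then have "x / mnorm N M < 1" using mnorm_pos[of M] by simp
      then show "mfun g M * counting (x / mnorm N M) = 0" using counting_eq_0 by simp
    qed
    then have "\<bar>T - c * x * sum ?f F\<bar> = \<bar>\<Sum>M\<in>F. mfun g M * (counting (x / mnorm N M) - c * (x / mnorm N M))\<bar>"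
      by (simp add: sum_distrib_left sum_subtractf algebra_simps)
    also have "\<dots> \<le> (\<Sum>M\<in>F. (\<bar>c\<bar> + C) * x powr (1/2 + e) * (\<bar>mfun g M\<bar> * mnorm N M powr (-(1/2 + e))))"
    proof (rule order_trans[OF sum_abs sum_mono])
      fix M assume "M \<in> F"
      then have "set_mset M \<subseteq> P" by (rule I)
      then have pos: "mnorm N M > 0" by (rule mnorm_pos)
      have "\<bar>mfun g M * (counting (x / mnorm N M) - c * (x / mnorm N M))\<bar>
          \<le> \<bar>mfun g M\<bar> * ((\<bar>c\<bar> + C) * (x / mnorm N M) powr (1/2 + e))"
        unfolding abs_mult using x e pos by (intro mult_left_mono counting_error) simp_all
      also have "(x / mnorm N M) powr (1/2 + e) = x powr (1/2 + e) * mnorm N M powr (-(1/2 + e))"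
        using x pos by (simp add: powr_divide powr_minus_divide del: minus_add_distrib)
      finally show "\<bar>mfun g M * (counting (x / mnorm N M) - c * (x / mnorm N M))\<bar>
        \<le> (\<bar>c\<bar> + C) * x powr (1/2 + e) * (\<bar>mfun g M\<bar> * mnorm N M powr (-(1/2 + e)))"
        by (simp only: mult_ac)
    qed
    also have "\<dots> = (\<bar>c\<bar> + C) * x powr (1/2 + e) * (\<Sum>M\<in>F. \<bar>mfun g M\<bar> * mnorm N M powr (-(1/2 + e)))"
      by (rule sum_distrib_left[symmetric])
    also have "\<dots> \<le> (\<bar>c\<bar> + C) * x powr (1/2 + e) * (error_const / e ^ m)"
      using C_nonneg by (intro mult_left_mono sum_abs_mfun_le[OF F(1) I e]) simp_all
    finally show ?thesis by (simp add: mult_ac)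
  qed
  have "(?f has_sum mean_value) ?I"
    unfolding mean_value_def by (intro has_sum_infsum summable_mfun_div) simp
  then have lim: "(sum ?f \<longlongrightarrow> mean_value) (finite_subsets_at_top ?I)"
    by (simp add: has_sum_def)
  have "\<bar>T - c * x * mean_value\<bar> \<le> (\<bar>c\<bar> + C) * error_const * x powr (1/2 + e) / e ^ m"
  proof (rule tendsto_upperbound)
    show "((\<lambda>F. \<bar>T - c * x * sum ?f F\<bar>) \<longlongrightarrow> \<bar>T - c * x * mean_value\<bar>) (finite_subsets_at_top ?I)"
      by (rule tendsto_rabs[OF tendsto_diff[OF tendsto_const tendsto_mult_left[OF lim]]])
    show "eventually (\<lambda>F. \<bar>T - c * x * sum ?f F\<bar> \<le> (\<bar>c\<bar> + C) * error_const * x powr (1/2 + e) / e ^ m)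
            (finite_subsets_at_top ?I)"
      unfolding eventually_finite_subsets_at_top
    proof (intro exI[of _ ?X] conjI allI impI)
      show "finite ?X" by (rule finite_le)
      show "?X \<subseteq> ?I" by (rule Collect_mono) simp
      show "\<bar>T - c * x * sum ?f F\<bar> \<le> (\<bar>c\<bar> + C) * error_const * x powr (1/2 + e) / e ^ m"
        if "finite F \<and> ?X \<subseteq> F \<and> F \<subseteq> ?I" for F
        using that by (elim conjE) (rule bound)
    qed
  qed simp
  then show ?thesis unfolding T_def by (simp add: mult_ac)
qed

text \<open>The choice e = 1 / ln x makes x^e the constant exp 1 and turns e^(-m) into the m-th
  power of the logarithm.\<close>

lemma sum_mfun_asymptotics:
  assumes t: "t 0 = 1" "\<And>n. (\<Sum>a\<le>n. g a) = t n" and r: "real m \<le> r"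
  shows "(\<lambda>x. (\<Sum>M | set_mset M \<subseteq> P \<and> mnorm N M \<le> x. mfun t M) - c * mean_value * x)
    \<in> O(\<lambda>x. sqrt x * ln x powr r)"
proof (rule bigoI)
  show "eventually (\<lambda>x. norm ((\<Sum>M | set_mset M \<subseteq> P \<and> mnorm N M \<le> x. mfun t M) - c * mean_value * x)
     \<le> ((\<bar>c\<bar> + C) * error_const * exp 1) * norm (sqrt x * ln x powr r)) at_top"
    \<comment> \<open>From exp 2 on, 1 / ln x is at most 1/2; also ln x \<ge> 1, so its exponent can
      be raised from \<open>m\<close> to \<open>r\<close>.\<close>
    using eventually_ge_at_top[of "exp 2"]
  proof eventually_elim
    fix x :: real assume "exp 2 \<le> x"
    moreover from this have "0 < x" by (rule less_le_trans[OF exp_gt_zero])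
    ultimately have x: "0 < x" "2 \<le> ln x" by (simp_all add: ln_ge_iff)
    define e where "e = 1 / ln x"
    have l: "0 < ln x" using x by linarith
    have e: "0 < e" "e \<le> 1/2"
      unfolding e_def using divide_pos_pos[OF zero_less_one l] frac_le[of 1 1 2 "ln x"] x by simp_all
    have D: "error_const \<ge> 0" unfolding error_const_def using C_nonneg by (intro mult_nonneg_nonneg zero_le_power) auto
    have "x powr (1/2 + e) = sqrt x * exp 1"
      using x l by (simp add: powr_add powr_half_sqrt) (simp add: powr_def e_def)
    moreover have "1 / e ^ m \<le> ln x powr r"
      using powr_mono[OF r, of "ln x"] x l by (simp add: e_def power_one_over powr_realpow)
    ultimately have "(\<bar>c\<bar> + C) * error_const * x powr (1/2 + e) * (1 / e ^ m)
        \<le> (\<bar>c\<bar> + C) * error_const * (sqrt x * exp 1) * (ln x powr r)"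
      using D C_nonneg x e by (intro mult_mono) auto
    then show "norm ((\<Sum>M | set_mset M \<subseteq> P \<and> mnorm N M \<le> x. mfun t M) - c * mean_value * x)
     \<le> ((\<bar>c\<bar> + C) * error_const * exp 1) * norm (sqrt x * ln x powr r)"
      using sum_mfun_error[OF t x(1) e] x by (simp add: abs_mult mult_ac)
  qed
qed

end

section \<open>Unique factorization of Gaussian integers\<close>

lemma gnorm_cmod: "gnorm z = (cmod z)\<^sup>2"
  by (simp add: gnorm_def cmod_power2)

lemma gnorm_mult: "gnorm (a * b) = gnorm a * gnorm b"
  by (simp add: gnorm_cmod norm_mult power_mult_distrib)

lemma gnorm_eq_0_iff [simp]: "gnorm z = 0 \<longleftrightarrow> z = 0"
  by (simp add: gnorm_cmod)

lemma gnorm_nonneg [simp]: "0 \<le> gnorm z"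
  by (simp add: gnorm_cmod)

lemma gint_0 [simp]: "gint 0" and gint_1 [simp]: "gint 1"
  by (simp_all add: gint_def)

lemma gint_mult [intro]: "gint a \<Longrightarrow> gint b \<Longrightarrow> gint (a * b)"
  and gint_add [intro]: "gint a \<Longrightarrow> gint b \<Longrightarrow> gint (a + b)"
  and gint_diff [intro]: "gint a \<Longrightarrow> gint b \<Longrightarrow> gint (a - b)"
  by (auto simp: gint_def)

lemma gnorm_Ints: "gint z \<Longrightarrow> gnorm z \<in> \<int>"
  by (auto simp: gint_def gnorm_def)

lemma gnorm_ge_1:
  assumes "gint z" "z \<noteq> 0"
  shows "1 \<le> gnorm z"
proof -
  obtain n where n: "gnorm z = of_int n" using gnorm_Ints[OF assms(1)] by (elim Ints_cases)
  have "0 < gnorm z" using assms(2) gnorm_nonneg[of z] by (simp add: less_le del: gnorm_nonneg)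
  then show ?thesis by (simp add: n)
qed

lemma gunit_cnj: "gunit u \<Longrightarrow> gunit (cnj u)" and gunit_mult_cnj: "gunit u \<Longrightarrow> u * cnj u = 1"
  by (auto simp: gunit_def gint_def gnorm_def complex_mult_cnj)

lemma gunit_mult [intro]: "gunit u \<Longrightarrow> gunit v \<Longrightarrow> gunit (u * v)"
  by (auto simp: gunit_def gnorm_mult)

lemma gunit_gint [intro]: "gunit u \<Longrightarrow> gint u"
  by (simp add: gunit_def)

lemma gunit_1 [simp]: "gunit 1" by (simp add: gunit_def gnorm_def)

lemma gunit_cases:
  assumes "gunit u"
  shows "u \<in> {1, -1, \<i>, -\<i>}"
proof -
  obtain a b :: int where ab: "Re u = of_int a" "Im u = of_int b"
    using assms by (auto simp: gunit_def gint_def elim!: Ints_cases)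
  have "real_of_int (a\<^sup>2 + b\<^sup>2) = of_int 1" using assms by (simp add: gunit_def gnorm_def ab)
  then have *: "a\<^sup>2 + b\<^sup>2 = 1" by (simp only: of_int_eq_iff)
  have "a\<^sup>2 \<le> 1\<^sup>2" "b\<^sup>2 \<le> 1\<^sup>2" using * zero_le_power2[of a] zero_le_power2[of b] unfolding one_power2 by linarith+
  then have "\<bar>a\<bar> \<le> 1" "\<bar>b\<bar> \<le> 1" using abs_le_square_iff[of a 1] abs_le_square_iff[of b 1] by simp_all
  then have "a \<in> {-1, 0, 1}" "b \<in> {-1, 0, 1}" by auto
  then show ?thesis using * ab by (auto simp: complex_eq_iff)
qed

lemma grep_gint [dest]: "grep z \<Longrightarrow> gint z" and grep_nonzero: "grep z \<Longrightarrow> z \<noteq> 0"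
  by (auto simp: grep_def)

lemma grep_1 [simp]: "grep 1" by (simp add: grep_def)

text \<open>Each unit other than 1 rotates the half-open quadrant of canonical representatives off
  itself.\<close>

lemma grep_unique:
  assumes "grep a" "grep b" "a = u * b" "gunit u"
  shows "a = b"
  using gunit_cases[OF assms(4)] assms by (auto simp: grep_def)

text \<open>The four rotated half-open quadrants cover the punctured plane.\<close>

lemma ex_grep:
  assumes "gint z" "z \<noteq> 0"
  shows "\<exists>u. gunit u \<and> grep (u * z)"
proof -
  have u: "gunit 1" "gunit (-1)" "gunit \<i>" "gunit (-\<i>)"
    by (auto simp: gunit_def gint_def gnorm_def)
  have gi: "gint (u * z)" if "gunit u" for u using that assms by auto
  have "Re z \<noteq> 0 \<or> Im z \<noteq> 0" using assms(2) by (auto simp: complex_eq_iff)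
  then have "Re z > 0 \<and> Im z \<ge> 0 \<or> Re z \<le> 0 \<and> Im z > 0 \<or> Re z < 0 \<and> Im z \<le> 0 \<or> Re z \<ge> 0 \<and> Im z < 0"
    by linarith
  then consider "Re z > 0" "Im z \<ge> 0" | "Re z \<le> 0" "Im z > 0" | "Re z < 0" "Im z \<le> 0" | "Re z \<ge> 0" "Im z < 0"
    by blast
  then show ?thesis
  proof cases
    case 1 then show ?thesis using assms gi[OF u(1)] by (intro exI[of _ 1]) (simp_all add: grep_def)
  next
    case 2 then show ?thesis using u(4) gi[OF u(4)] by (intro exI[of _ "-\<i>"]) (simp_all add: grep_def)
  next
    case 3 then show ?thesis using u(2) gi[OF u(2)] by (intro exI[of _ "-1"]) (simp_all add: grep_def)
  next
    case 4 then show ?thesis using u(3) gi[OF u(3)] by (intro exI[of _ \<i>]) (simp_all add: grep_def)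
  qed
qed

definition gnormalize :: "complex \<Rightarrow> complex" where
  "gnormalize z = (SOME w. grep w \<and> (\<exists>u. gunit u \<and> w = u * z))"

lemma gnormalize:
  assumes "gint z" "z \<noteq> 0"
  shows "grep (gnormalize z)" "\<exists>u. gunit u \<and> gnormalize z = u * z"
proof -
  have "\<exists>w. grep w \<and> (\<exists>u. gunit u \<and> w = u * z)" using ex_grep[OF assms] by blast
  from someI_ex[OF this] show "grep (gnormalize z)" "\<exists>u. gunit u \<and> gnormalize z = u * z"
    unfolding gnormalize_def by blast+
qed

section \<open>Divisibility, Euclidean division and Euclid's lemma\<close>

lemma gdvd_trans: "gdvd a b \<Longrightarrow> gdvd b c \<Longrightarrow> gdvd a c"
  unfolding gdvd_def by (auto simp: mult.assoc)

lemma gdvd_mult: "gdvd a b \<Longrightarrow> gint c \<Longrightarrow> gdvd a (b * c)"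
  unfolding gdvd_def by (auto simp: mult.assoc)

lemma gdvd_unit_left_iff: "gunit u \<Longrightarrow> gdvd a (u * b) \<longleftrightarrow> gdvd a b"
proof -
  assume u: "gunit u"
  have b: "(u * b) * cnj u = b" using gunit_mult_cnj[OF u] by (simp add: mult.commute mult.left_commute)
  show ?thesis
    using gdvd_mult[of a "u * b" "cnj u"] gdvd_mult[of a b u] gunit_gint[OF u] gunit_gint[OF gunit_cnj[OF u]]
    unfolding b by (auto simp: mult.commute)
qed

text \<open>Rounding both coordinates of a/b leaves a remainder quotient of norm at most 1/4 + 1/4 <
  1.\<close>

lemma gint_division:
  assumes "gint a" "gint b" "b \<noteq> 0"
  obtains q where "gint q" "gnorm (a - q * b) < gnorm b"
proof -
  define z where "z = a / b"
  define q where "q = Complex (of_int (round (Re z))) (of_int (round (Im z)))"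
  have "\<bar>Re (z - q)\<bar> \<le> 1/2" "\<bar>Im (z - q)\<bar> \<le> 1/2"
    unfolding q_def using of_int_round_abs_le[of "Re z"] of_int_round_abs_le[of "Im z"]
    by (simp_all add: abs_minus_commute)
  then have "(Re (z - q))\<^sup>2 \<le> (1/2)\<^sup>2" "(Im (z - q))\<^sup>2 \<le> (1/2)\<^sup>2"
    using abs_le_square_iff[of "Re (z - q)" "1/2"] abs_le_square_iff[of "Im (z - q)" "1/2"] by simp_all
  then have "gnorm (z - q) < 1" by (simp add: gnorm_def power2_eq_square)
  then have "gnorm (z - q) * gnorm b < 1 * gnorm b"
    using assms(3) by (intro mult_strict_right_mono) (auto simp: less_le)
  moreover have "(z - q) * b = a - q * b" using assms(3) by (simp add: z_def field_simps)
  ultimately have "gnorm (a - q * b) < gnorm b" by (simp flip: gnorm_mult)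
  moreover have "gint q" by (simp add: q_def gint_def)
  ultimately show ?thesis using that by blast
qed

text \<open>A nonzero element of least norm in the ideal generated by \<open>a\<close> and
  \<open>b\<close> divides everything in it, as a nonzero remainder would be smaller. Norms pass
  through \<open>nat\<close> to use well-ordering.\<close>

lemma gint_bezout:
  assumes "gint a" "gint b" "a \<noteq> 0"
  obtains u v where "gint u" "gint v" "gdvd (a * u + b * v) a" "gdvd (a * u + b * v) b"
proof -
  define I where "I = {z. z \<noteq> 0 \<and> (\<exists>u v. gint u \<and> gint v \<and> z = a * u + b * v)}"
  have "a \<in> I" 
    unfolding I_def using assms by (intro CollectI conjI exI[of _ 1] exI[of _ 0]) auto
  then obtain d where d: "d \<in> I" "\<And>z. z \<in> I \<Longrightarrow> nat \<lfloor>gnorm d\<rfloor> \<le> nat \<lfloor>gnorm z\<rfloor>"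
    using ex_has_least_nat[of "\<lambda>z. z \<in> I" a "\<lambda>z. nat \<lfloor>gnorm z\<rfloor>"] by blast
  then obtain u v where uv: "gint u" "gint v" "d = a * u + b * v" "d \<noteq> 0" unfolding I_def by blast
  have gd: "gint d" using uv assms by auto
  have dvd: "gdvd d z" if z: "gint z" "\<exists>u v. gint u \<and> gint v \<and> z = a * u + b * v" for z
  proof -
    obtain s t where st: "gint s" "gint t" "z = a * s + b * t" using z by blast
    obtain q where q: "gint q" "gnorm (z - q * d) < gnorm d"
      using gint_division[OF z(1) gd uv(4)] by blast
    have eq: "z - q * d = a * (s - q * u) + b * (t - q * v)"
      unfolding st uv(3) by (simp add: algebra_simps)
    have "z - q * d = 0"
    proof (rule ccontr)
      assume nz: "z - q * d \<noteq> 0"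
      then have "z - q * d \<in> I" unfolding I_def using eq st q uv
        by (intro CollectI conjI exI[of _ "s - q * u"] exI[of _ "t - q * v"]) auto
      then have le: "nat \<lfloor>gnorm d\<rfloor> \<le> nat \<lfloor>gnorm (z - q * d)\<rfloor>" by (rule d(2))
      have "gint (z - q * d)" using z q gd by auto
      then obtain m n where "gnorm (z - q * d) = of_int m" "gnorm d = of_int n"
        using gnorm_Ints gd by (metis Ints_cases)
      then show False using le q(2) gnorm_nonneg[of "z - q * d"] by auto
    qed
    then show ?thesis unfolding gdvd_def using q by (intro exI[of _ q]) (auto simp: algebra_simps)
  qed
  show ?thesis
  proof (rule that[OF uv(1,2)])
    show "gdvd (a * u + b * v) a"
      unfolding uv(3)[symmetric] using assms by (intro dvd exI[of _ 1] exI[of _ 0]) auto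
    show "gdvd (a * u + b * v) b"
      unfolding uv(3)[symmetric] using assms by (intro dvd exI[of _ 0] exI[of _ 1]) auto
  qed
qed

text \<open>\<open>gprime\<close> is irreducibility, so primality needs Bezout: the common divisor d
  = pu + av of \<open>p\<close> and \<open>a\<close> is either associated to \<open>p\<close>,
  whence p divides a, or a unit, and then b is a multiple of p because p divides both p and
  ab.\<close>

lemma gprime_gdvd_mult:
  assumes p: "gprime p" and ab: "gint a" "gint b" "gdvd p (a * b)"
  shows "gdvd p a \<or> gdvd p b"
proof -
  have gp: "gint p" "p \<noteq> 0" using p by (auto simp: gprime_def)
  obtain u v where uv: "gint u" "gint v" "gdvd (p * u + a * v) p" "gdvd (p * u + a * v) a"
    by (rule gint_bezout[OF gp(1) ab(1) gp(2)])
  define d where "d = p * u + a * v"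
  have gd: "gint d" unfolding d_def using uv gp ab by auto
  obtain c where c: "gint c" "p = d * c" using uv(3) by (auto simp: gdvd_def d_def)
  then have "gunit d \<or> gunit c" using p gd by (auto simp: gprime_def)
  then show ?thesis
  proof
    assume "gunit c"
    then have "gdvd p d"
      unfolding gdvd_def using gunit_mult_cnj[of c] gunit_gint[OF gunit_cnj[of c]] c(2)
      by (intro exI[of _ "cnj c"]) (simp add: mult.assoc)
    then show ?thesis using gdvd_trans uv(4) d_def by blast
  next
    assume "gunit d"
    then have d: "gint (cnj d)" "d * cnj d = 1" using gunit_cnj gunit_mult_cnj by auto
    obtain e where e: "gint e" "a * b = p * e" using ab(3) by (auto simp: gdvd_def)
    have "b = (d * cnj d) * b" using d by simp
    also have "\<dots> = cnj d * (p * u * b + v * (a * b))" unfolding d_def by (simp add: algebra_simps)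
    also have "\<dots> = p * (cnj d * (u * b + v * e))" unfolding e by (simp add: algebra_simps)
    finally have "b = p * (cnj d * (u * b + v * e))" .
    moreover have "gint (cnj d * (u * b + v * e))" using d uv ab e by (intro gint_mult gint_add)
    ultimately have "gdvd p b" unfolding gdvd_def by blast
    then show ?thesis by blast
  qed
qed

section \<open>Factorization into canonical primes\<close>

definition gprimes :: "complex set" where
  "gprimes = {p. grep p \<and> gprime p}"

lemma gprimesD: 
  assumes "p \<in> gprimes"
  shows "grep p" "gprime p" "gint p" "p \<noteq> 0" "\<not> gunit p"
  using assms by (auto simp: gprimes_def gprime_def)

lemma prod_gprimes:
  assumes "set_mset M \<subseteq> gprimes"
  shows "gint (prod_mset M)" "prod_mset M \<noteq> 0"
proof -
  show "gint (prod_mset M)" using assms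
    by (induction M) (auto intro!: gint_mult dest!: gprimesD(3))
  show "prod_mset M \<noteq> 0" using assms
    by (induction M) (auto dest!: gprimesD(4))
qed

lemma gnorm_prod_mset: "gnorm (prod_mset M) = mnorm gnorm M"
  by (induction M) (auto simp: gnorm_mult mnorm_def gnorm_def[of 1])

lemma gnorm_gnormalize:
  assumes "gint z" "z \<noteq> 0"
  shows "gnorm (gnormalize z) = gnorm z"
  using gnormalize(2)[OF assms] by (auto simp: gnorm_mult gunit_def)

lemma gprimes_eqI:
  assumes "p \<in> gprimes" "q \<in> gprimes" "gdvd p q"
  shows "p = q"
proof -
  obtain c where c: "gint c" "q = p * c" using assms(3) by (auto simp: gdvd_def)
  have "gunit p \<or> gunit c"
    using gprimesD(2)[OF assms(2)] gprimesD(3)[OF assms(1)] c unfolding gprime_def by blast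
  then have "gunit c" using gprimesD(5)[OF assms(1)] by simp
  then have "q = p" using c gprimesD(1)[OF assms(1)] gprimesD(1)[OF assms(2)]
    by (intro grep_unique[of q p c]) (simp_all add: mult.commute)
  then show ?thesis by simp
qed

lemma gdvd_prod_gprimes_iff:
  assumes p: "p \<in> gprimes" and M: "set_mset M \<subseteq> gprimes"
  shows "gdvd p (prod_mset M) \<longleftrightarrow> p \<in># M"
proof
  show "p \<in># M \<Longrightarrow> gdvd p (prod_mset M)"
  proof -
    assume "p \<in># M"
    then have "M = {#p#} + (M - {#p#})" by simp
    then have "prod_mset M = p * prod_mset (M - {#p#})" by (metis prod_mset.add_mset add_mset_add_single union_commute)
    moreover have "gint (prod_mset (M - {#p#}))"
      using M by (intro prod_gprimes) (auto dest: in_diffD)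
    ultimately show ?thesis by (auto simp: gdvd_def)
  qed
  show "gdvd p (prod_mset M) \<Longrightarrow> p \<in># M" using M
  proof (induction M)
    case empty
    then obtain c where "gint c" "1 = p * c" by (auto simp: gdvd_def)
    then have "gnorm p * gnorm c = 1" "gint c" "c \<noteq> 0"
      by (auto simp: gnorm_mult[symmetric] gnorm_def[of 1])
    moreover have "1 \<le> gnorm p" "1 \<le> gnorm c"
      using \<open>c \<noteq> 0\<close> \<open>gint c\<close> gprimesD[OF p] by (auto intro: gnorm_ge_1)
    then have "gnorm p * 1 \<le> gnorm p * gnorm c" by (intro mult_left_mono) auto
    ultimately have "gnorm p = 1" using \<open>1 \<le> gnorm p\<close> by simp
    then show ?case using gprimesD[OF p] by (simp add: gunit_def)
  next
    case (add q M)
    have q: "q \<in> gprimes" and M: "set_mset M \<subseteq> gprimes" using add.prems by auto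
    have "gdvd p q \<or> gdvd p (prod_mset M)"
      using add.prems(1) gprimesD(3)[OF q] prod_gprimes(1)[OF M]
      by (intro gprime_gdvd_mult gprimesD(2)[OF p]) simp_all
    then show ?case using gprimes_eqI[OF p q] add.IH[OF _ M] by auto
  qed
qed

text \<open>Split off the full power of \<open>p\<close>. The cofactor is not divisible by
  \<open>p\<close>, so the admissible exponents form exactly an initial segment, whose
  \<open>Max\<close> is the count.\<close>

lemma gmult_prod_gprimes:
  assumes p: "p \<in> gprimes" and M: "set_mset M \<subseteq> gprimes"
  shows "gmult p (prod_mset M) = count M p"
proof -
  define b where "b = prod_mset (filter_mset (\<lambda>q. q \<noteq> p) M)"
  have M': "set_mset (filter_mset (\<lambda>q. q \<noteq> p) M) \<subseteq> gprimes" using M by auto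
  have b: "gint b" "b \<noteq> 0" "\<not> gdvd p b"
    unfolding b_def using prod_gprimes[OF M'] gdvd_prod_gprimes_iff[OF p M'] by auto
  have "M = replicate_mset (count M p) p + filter_mset (\<lambda>q. q \<noteq> p) M"
    by (rule multiset_eqI) auto
  then have eq: "prod_mset M = p ^ count M p * b"
    unfolding b_def by (metis prod_mset.union prod_mset_replicate_mset)
  have gp: "gint (p ^ n)" for n using gprimesD(3)[OF p] by (induction n) auto
  have "{n. gdvd (p ^ n) (prod_mset M)} = {..count M p}"
  proof (intro equalityI subsetI)
    fix n assume n: "n \<in> {..count M p}"
    then have "prod_mset M = p ^ n * (p ^ (count M p - n) * b)"
      unfolding eq by (simp flip: power_add mult.assoc)
    moreover have "gint (p ^ (count M p - n) * b)" using gp b by auto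
    ultimately show "n \<in> {n. gdvd (p ^ n) (prod_mset M)}" unfolding gdvd_def by blast
  next
    fix n assume "n \<in> {n. gdvd (p ^ n) (prod_mset M)}"
    then obtain c where c: "gint c" "p ^ count M p * b = p ^ n * c" unfolding eq gdvd_def by blast
    show "n \<in> {..count M p}"
    proof (rule ccontr)
      assume "n \<notin> {..count M p}"
      then obtain j where j: "n = count M p + Suc j" by (auto simp: not_le dest: less_imp_Suc_add)
      have "p ^ count M p * b = p ^ count M p * (p * (p ^ j * c))"
        unfolding c(2) j by (simp add: power_add mult.assoc)
      then have "b = p * (p ^ j * c)" using gprimesD(4)[OF p] by simp
      moreover have "gint (p ^ j * c)" using gp c by auto
      ultimately show False using b(3) by (auto simp: gdvd_def)
    qed
  qed
  then show ?thesis unfolding gmult_def by (auto intro: Max_eqI)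
qed

lemma gdvd_gnormalize_iff:
  assumes "gint z" "z \<noteq> 0"
  shows "gdvd a (gnormalize z) \<longleftrightarrow> gdvd a z"
  using gnormalize(2)[OF assms] gdvd_unit_left_iff by auto

lemma gmult_gnormalize:
  assumes "gint z" "z \<noteq> 0"
  shows "gmult p (gnormalize z) = gmult p z"
  unfolding gmult_def by (simp only: gdvd_gnormalize_iff[OF assms])

lemma gprime_gnormalize:
  assumes "gprime p"
  shows "gnormalize p \<in> gprimes"
proof -
  have p: "gint p" "p \<noteq> 0" "\<not> gunit p" using assms by (auto simp: gprime_def)
  obtain u where u: "gunit u" "gnormalize p = u * p" using gnormalize(2)[OF p(1,2)] by blast
  have "gunit a \<or> gunit b" if ab: "gint a" "gint b" "gnormalize p = a * b" for a b
  proof -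
    have "p = (cnj u * u) * p" using gunit_mult_cnj[OF u(1)] by (simp add: mult.commute)
    also have "\<dots> = (cnj u * a) * b" using ab(3) u(2) by (simp add: mult.assoc)
    finally have "gunit (cnj u * a) \<or> gunit b"
      using assms ab(1,2) gunit_gint[OF gunit_cnj[OF u(1)]] unfolding gprime_def by blast
    then show ?thesis
      using gunit_cnj[OF u(1)] ab(1) by (auto simp: gunit_def gnorm_mult)
  qed
  moreover have "\<not> gunit (gnormalize p)"
    using p gnorm_gnormalize[OF p(1,2)] by (auto simp: gunit_def)
  ultimately show ?thesis
    unfolding gprimes_def gprime_def using gnormalize(1)[OF p(1,2)] grep_nonzero by auto
qed

text \<open>Strong induction on the norm: a nonzero nonunit that is not prime splits into two
  nonunits, both of strictly smaller norm.\<close>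

lemma ex_gprime_factorization:
  assumes "gint z" "z \<noteq> 0"
  shows "\<exists>M u. set_mset M \<subseteq> gprimes \<and> gunit u \<and> z = u * prod_mset M"
  using assms
proof (induction "nat \<lfloor>gnorm z\<rfloor>" arbitrary: z rule: less_induct)
  case less
  show ?case
  proof (cases "gunit z")
    case True
    then show ?thesis by (intro exI[of _ "{#}"] exI[of _ z]) simp
  next
    case nu: False
    show ?thesis
    proof (cases "gprime z")
      case True
      obtain u where u: "gunit u" "gnormalize z = u * z" using gnormalize(2)[OF less.prems] by blast
      have "z = cnj u * gnormalize z"
        unfolding u using gunit_mult_cnj[OF u(1)] by (simp add: mult.commute mult.left_commute)
      then show ?thesis using gprime_gnormalize[OF True] gunit_cnj[OF u(1)]
        by (intro exI[of _ "{#gnormalize z#}"] exI[of _ "cnj u"]) simp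
    next
      case False
      then obtain a b where ab: "gint a" "gint b" "z = a * b" "\<not> gunit a" "\<not> gunit b"
        using less.prems nu unfolding gprime_def by blast
      have small: "nat \<lfloor>gnorm c\<rfloor> < nat \<lfloor>gnorm (c * d)\<rfloor>"
        if cd: "gint c" "gint d" "c \<noteq> 0" "d \<noteq> 0" "\<not> gunit d" for c d
      proof -
        obtain m where m: "gnorm c = of_int m" using gnorm_Ints[OF cd(1)] by (elim Ints_cases)
        obtain n where n: "gnorm d = of_int n" using gnorm_Ints[OF cd(2)] by (elim Ints_cases)
        have "1 \<le> gnorm c" "1 \<le> gnorm d" "gnorm d \<noteq> 1"
          using gnorm_ge_1[OF cd(1,3)] gnorm_ge_1[OF cd(2,4)] cd(2,5) by (simp_all add: gunit_def)
        then have mn: "1 \<le> m" "1 < n" by (simp_all add: m n)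
        then have "m * 1 < m * n" by (intro mult_strict_left_mono) simp_all
        moreover have "\<lfloor>gnorm c\<rfloor> = m" by (simp add: m)
        moreover have "\<lfloor>gnorm (c * d)\<rfloor> = m * n" by (simp only: gnorm_mult m n floor_of_int flip: of_int_mult)
        ultimately show ?thesis using mn by simp
      qed
      have nz: "a \<noteq> 0" "b \<noteq> 0" using ab less.prems by auto
      obtain M u where M: "set_mset M \<subseteq> gprimes" "gunit u" "a = u * prod_mset M"
        using less.hyps[OF small[OF ab(1,2) nz ab(5), folded ab(3)] ab(1) nz(1)] by blast
      have "nat \<lfloor>gnorm b\<rfloor> < nat \<lfloor>gnorm z\<rfloor>"
        using small[OF ab(2,1) nz(2,1) ab(4)] by (simp only: ab(3) mult.commute)
      then obtain M' u' where M': "set_mset M' \<subseteq> gprimes" "gunit u'" "b = u' * prod_mset M'"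
        using less.hyps[OF _ ab(2) nz(2)] by blast
      have "z = (u * u') * prod_mset (M + M')" using ab(3) M(3) M'(3) by simp
      then show ?thesis using M M'
        by (intro exI[of _ "M + M'"] exI[of _ "u * u'"]) (simp add: gunit_mult)
    qed
  qed
qed

text \<open>Unique factorization with the norm cutoff. Injectivity holds because
  \<open>gmult\<close> recovers every count from the product; surjectivity is existence of
  factorizations.\<close>

lemma bij_betw_gprime_factorization:
  "bij_betw (\<lambda>M. gnormalize (prod_mset M))
     {M. set_mset M \<subseteq> gprimes \<and> mnorm gnorm M \<le> x} {\<alpha>. grep \<alpha> \<and> gnorm \<alpha> \<le> x}"
proof (rule bij_betw_imageI)
  show "inj_on (\<lambda>M. gnormalize (prod_mset M)) {M. set_mset M \<subseteq> gprimes \<and> mnorm gnorm M \<le> x}"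
  proof (rule inj_onI, rule multiset_eqI)
    fix M M' p
    assume "M \<in> {M. set_mset M \<subseteq> gprimes \<and> mnorm gnorm M \<le> x}"
      and "M' \<in> {M. set_mset M \<subseteq> gprimes \<and> mnorm gnorm M \<le> x}"
      and eq: "gnormalize (prod_mset M) = gnormalize (prod_mset M')"
    then have M: "set_mset M \<subseteq> gprimes" "set_mset M' \<subseteq> gprimes" by auto
    show "count M p = count M' p"
    proof (cases "p \<in> gprimes")
      case True
      then show ?thesis
        using gmult_gnormalize[OF prod_gprimes[OF M(1)], of p]
          gmult_gnormalize[OF prod_gprimes[OF M(2)], of p] eq
          gmult_prod_gprimes[OF True M(1)] gmult_prod_gprimes[OF True M(2)] by simp
    next
      case False
      then have "p \<notin># M" "p \<notin># M'" using M by auto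
      then show ?thesis by (simp add: not_in_iff)
    qed
  qed
  show "(\<lambda>M. gnormalize (prod_mset M)) ` {M. set_mset M \<subseteq> gprimes \<and> mnorm gnorm M \<le> x}
          = {\<alpha>. grep \<alpha> \<and> gnorm \<alpha> \<le> x}"
  proof (intro equalityI subsetI)
    fix \<alpha> assume "\<alpha> \<in> (\<lambda>M. gnormalize (prod_mset M)) ` {M. set_mset M \<subseteq> gprimes \<and> mnorm gnorm M \<le> x}"
    then obtain M where M: "set_mset M \<subseteq> gprimes" "mnorm gnorm M \<le> x" "\<alpha> = gnormalize (prod_mset M)" by auto
    then show "\<alpha> \<in> {\<alpha>. grep \<alpha> \<and> gnorm \<alpha> \<le> x}"
      using gnormalize(1)[OF prod_gprimes[OF M(1)]] gnorm_gnormalize[OF prod_gprimes[OF M(1)]]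
      by (simp add: gnorm_prod_mset)
  next
    fix \<alpha> assume "\<alpha> \<in> {\<alpha>. grep \<alpha> \<and> gnorm \<alpha> \<le> x}"
    then have \<alpha>: "grep \<alpha>" "gnorm \<alpha> \<le> x" by auto
    obtain M u where M: "set_mset M \<subseteq> gprimes" "gunit u" "\<alpha> = u * prod_mset M"
      using ex_gprime_factorization[OF grep_gint[OF \<alpha>(1)] grep_nonzero[OF \<alpha>(1)]] by blast
    obtain v where v: "gunit v" "gnormalize (prod_mset M) = v * prod_mset M"
      using gnormalize(2)[OF prod_gprimes[OF M(1)]] by blast
    have "prod_mset M = cnj v * (v * prod_mset M)"
      using gunit_mult_cnj[OF v(1)] by (simp add: mult.commute mult.left_commute)
    then have "\<alpha> = (u * cnj v) * gnormalize (prod_mset M)"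
      unfolding v(2) M(3) by (simp add: mult.assoc)
    then have "\<alpha> = gnormalize (prod_mset M)"
      by (rule grep_unique[OF \<alpha>(1) gnormalize(1)[OF prod_gprimes[OF M(1)]]])
        (intro gunit_mult gunit_cnj v M)
    moreover have "mnorm gnorm M \<le> x"
      using \<alpha>(2) M(2,3) by (simp add: gnorm_mult gnorm_prod_mset gunit_def)
    ultimately show "\<alpha> \<in> (\<lambda>M. gnormalize (prod_mset M)) ` {M. set_mset M \<subseteq> gprimes \<and> mnorm gnorm M \<le> x}"
      using M(1) by blast
  qed
qed

text \<open>Under unique factorization the canonical prime divisors are the support of the multiset,
  and \<open>gmult\<close> gives its counts.\<close>

lemma gsum_eq_sum_mfun:
  assumes "\<And>\<alpha>. f \<alpha> = (\<Prod>p\<in>{p. grep p \<and> gprime p \<and> gdvd p \<alpha>}. t (gmult p \<alpha>))"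
  shows "gsum f x = (\<Sum>M | set_mset M \<subseteq> gprimes \<and> mnorm gnorm M \<le> x. mfun (\<lambda>a. real (t a)) M)"
proof -
  have "gsum f x = (\<Sum>M | set_mset M \<subseteq> gprimes \<and> mnorm gnorm M \<le> x. real (f (gnormalize (prod_mset M))))"
    unfolding gsum_def by (rule sum.reindex_bij_betw[OF bij_betw_gprime_factorization, symmetric])
  also have "\<dots> = (\<Sum>M | set_mset M \<subseteq> gprimes \<and> mnorm gnorm M \<le> x. mfun (\<lambda>a. real (t a)) M)"
  proof (rule sum.cong)
    fix M assume "M \<in> {M. set_mset M \<subseteq> gprimes \<and> mnorm gnorm M \<le> x}"
    then have M: "set_mset M \<subseteq> gprimes" by simp
    have set: "{p. grep p \<and> gprime p \<and> gdvd p (gnormalize (prod_mset M))} = set_mset M"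
      using M gdvd_prod_gprimes_iff[OF _ M]
      unfolding gdvd_gnormalize_iff[OF prod_gprimes[OF M]] by (auto simp: gprimes_def)
    have "(\<Prod>p\<in>set_mset M. t (gmult p (gnormalize (prod_mset M)))) = (\<Prod>p\<in>set_mset M. t (count M p))"
      unfolding gmult_gnormalize[OF prod_gprimes[OF M]]
    proof (rule prod.cong)
      fix p assume "p \<in># M"
      then show "t (gmult p (prod_mset M)) = t (count M p)"
        using M by (subst gmult_prod_gprimes) auto
    qed simp
    then show "real (f (gnormalize (prod_mset M))) = mfun (\<lambda>a. real (t a)) M"
      by (simp add: assms set mfun_def)
  qed simp
  finally show ?thesis .
qed

section \<open>Lattice points in a quarter disc\<close>

lemma quarter_disc_antideriv:
  fixes R z :: real
  assumes "0 < z" "z < R"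
  shows "((\<lambda>t. (t * sqrt (R\<^sup>2 - t\<^sup>2) + R\<^sup>2 * arcsin (t / R)) / 2)
    has_real_derivative sqrt (R\<^sup>2 - z\<^sup>2)) (at z)"
proof -
  have "z\<^sup>2 < R\<^sup>2" using assms by (intro power_strict_mono) auto
  then have pos: "0 < R\<^sup>2 - z\<^sup>2" by simp
  define w where "w = sqrt (R\<^sup>2 - z\<^sup>2)"
  have w: "w > 0" "w\<^sup>2 = R\<^sup>2 - z\<^sup>2" unfolding w_def using pos by auto
  have "1 - (z / R)\<^sup>2 = (R\<^sup>2 - z\<^sup>2) / R\<^sup>2" using assms by (simp add: field_simps)
  then have s: "sqrt (1 - (z / R)\<^sup>2) = w / R"
    using assms by (simp add: real_sqrt_divide w_def)
  have d1: "((\<lambda>t. sqrt (R\<^sup>2 - t\<^sup>2)) has_real_derivative (- z / w)) (at z)"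
    unfolding w_def using pos by (auto intro!: derivative_eq_intros simp: field_simps)
  have d2: "((\<lambda>t. arcsin (t / R)) has_real_derivative (1 / w)) (at z)"
  proof -
    have "((\<lambda>t. arcsin (t / R)) has_real_derivative (inverse (sqrt (1 - (z / R)\<^sup>2)) * (1 / R))) (at z)"
      using assms by (intro DERIV_chain2[of arcsin] DERIV_arcsin DERIV_cdivide DERIV_ident) (auto simp: field_simps)
    then show ?thesis using assms by (simp add: s)
  qed
  have "((\<lambda>t. (t * sqrt (R\<^sup>2 - t\<^sup>2) + R\<^sup>2 * arcsin (t / R)) / 2)
    has_real_derivative (1 * sqrt (R\<^sup>2 - z\<^sup>2) + (- z / w) * z + R\<^sup>2 * (1 / w)) / 2) (at z)"
    by (intro DERIV_cdivide DERIV_add DERIV_mult DERIV_cmult d1 d2 DERIV_ident)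
  \<comment> \<open>Since R^2 - z^2 = w^2, the expression is (w + w^2/w) / 2.\<close>
  moreover have "(1 * sqrt (R\<^sup>2 - z\<^sup>2) + (- z / w) * z + R\<^sup>2 * (1 / w)) / 2 = w"
  proof -
    have "(1 * w + (- z / w) * z + R\<^sup>2 * (1 / w)) / 2 = (w + (R\<^sup>2 - z\<^sup>2) / w) / 2"
      by (simp add: diff_divide_distrib power2_eq_square)
    also have "\<dots> = w" unfolding w(2)[symmetric] using w(1) by (simp add: power2_eq_square)
    finally show ?thesis unfolding w_def .
  qed
  ultimately show ?thesis by (simp only: w_def)
qed

text \<open>The height function decreases from R to 0, so its sum at integers lies between the
  quarter-disc area minus R and the area. The absolute value centres this interval.\<close>

lemma gauss_circle_quadrant:
  fixes R :: real
  assumes R: "0 < R" and n: "real n \<le> R" "R < real n + 1"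
  shows "\<bar>(\<Sum>a=1..n. sqrt (R\<^sup>2 - (real a)\<^sup>2)) - pi / 4 * R\<^sup>2 + R / 2\<bar> \<le> R / 2"
proof -
  define h where "h t = sqrt (R\<^sup>2 - t\<^sup>2)" for t
  define H where "H t = (t * h t + R\<^sup>2 * arcsin (t / R)) / 2" for t
  have antimono: "h t \<le> h s" if "0 \<le> s" "s \<le> t" for s t
    unfolding h_def using that by (intro real_sqrt_le_mono diff_left_mono power_mono) auto
  have h_nn: "0 \<le> h t" if "0 \<le> t" "t \<le> R" for t
    unfolding h_def using that power_mono[of t R 2] by simp
  have step: "h t * (t - s) \<le> H t - H s" "H t - H s \<le> h s * (t - s)"
    if st: "0 \<le> s" "s \<le> t" "t \<le> R" for s t
  proof -
    have "h t * (t - s) \<le> H t - H s \<and> H t - H s \<le> h s * (t - s)"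
    proof (cases "s = t")
      case False
      \<comment> \<open>The mean value theorem asks for a derivative only in the interior, so s = 0
        and t = R are allowed although the antiderivative lemma excludes them.\<close>
      have "\<exists>l z. s < z \<and> z < t \<and> DERIV H z :> l \<and> H t - H s = (t - s) * l"
      proof (rule MVT)
        show "s < t" using False st by simp
        show "continuous_on {s..t} H"
          unfolding H_def h_def using st R
          by (intro continuous_intros) (auto simp: field_simps)
        show "H differentiable (at z)" if "s < z" "z < t" for z
          unfolding H_def[abs_def] h_def real_differentiable_def
          using quarter_disc_antideriv[of z R] that st by (intro exI) auto
      qed
      then obtain l z where z: "s < z" "z < t" "DERIV H z :> l" "H t - H s = (t - s) * l" by blast
      have "DERIV H z :> h z"
        unfolding H_def[abs_def] h_def using z st by (intro quarter_disc_antideriv) auto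
      then have "l = h z" using z(3) DERIV_unique by blast
      moreover have "h t \<le> h z" "h z \<le> h s" using z st by (auto intro: antimono)
      ultimately show ?thesis
        unfolding z(4) using st by (simp add: mult.commute[of "t - s"] mult_right_mono)
    qed simp
    then show "h t * (t - s) \<le> H t - H s" "H t - H s \<le> h s * (t - s)" by auto
  qed
  have H0: "H 0 = 0" and HR: "H R = pi / 4 * R\<^sup>2"
    using R by (simp_all add: H_def h_def)
  have h0: "h 0 = R" using R by (simp add: h_def)
  \<comment> \<open>Right and left endpoint sums over unit intervals bracket the increments of
    \<open>H\<close>; their difference telescopes to R - h j.\<close>
  have lower: "(\<Sum>a=1..j. h (real a)) \<le> H (real j)" and
       upper: "H (real j) \<le> R - h (real j) + (\<Sum>a=1..j. h (real a))" if "j \<le> n" for j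
  proof -
    have "(\<Sum>a=1..j. h (real a)) \<le> H (real j) \<and> H (real j) \<le> R - h (real j) + (\<Sum>a=1..j. h (real a))"
      using that
    proof (induction j)
      case 0
      then show ?case by (simp add: H0 h0)
    next
      case (Suc j)
      have "real (Suc j) \<le> real n" using Suc.prems by (simp only: of_nat_le_iff)
      then show ?case using Suc step[of "real j" "real (Suc j)"] n by simp
    qed
    then show "(\<Sum>a=1..j. h (real a)) \<le> H (real j)"
      "H (real j) \<le> R - h (real j) + (\<Sum>a=1..j. h (real a))" by auto
  qed
  \<comment> \<open>The leftover interval from n to R has length below 1; its contribution is
    absorbed by the term - h n of the upper bound.\<close>
  have last: "0 \<le> H R - H (real n)" "H R - H (real n) \<le> h (real n)"
  proof -
    have "0 \<le> h R * (R - real n)" using h_nn[of R] R n by (intro mult_nonneg_nonneg) auto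
    then show "0 \<le> H R - H (real n)" using step(1)[of "real n" R] n by simp
    have "h (real n) * (R - real n) \<le> h (real n) * 1" using h_nn[of "real n"] n by (intro mult_left_mono) auto
    then show "H R - H (real n) \<le> h (real n)" using step(2)[of "real n" R] n by simp
  qed
  have "(\<Sum>a=1..n. h (real a)) \<le> H R" "H R \<le> R + (\<Sum>a=1..n. h (real a))"
    using lower[of n] upper[of n] last by simp_all
  then show ?thesis unfolding HR h_def by linarith
qed

lemma grep_norm_le_bij:
  assumes "0 < x"
  shows "bij_betw (\<lambda>(a, b). Complex (real a) (real b))
    (SIGMA a:{1..nat \<lfloor>sqrt x\<rfloor>}. {..nat \<lfloor>sqrt (x - (real a)\<^sup>2)\<rfloor>}) {z. grep z \<and> gnorm z \<le> x}"
proof (rule bij_betw_imageI)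
  let ?S = "SIGMA a:{1..nat \<lfloor>sqrt x\<rfloor>}. {..nat \<lfloor>sqrt (x - (real a)\<^sup>2)\<rfloor>}"
  have le_floor_sqrt: "a \<le> nat \<lfloor>sqrt y\<rfloor> \<longleftrightarrow> (real a)\<^sup>2 \<le> y" if "0 \<le> y" for a :: nat and y :: real
  proof -
    have "a \<le> nat \<lfloor>sqrt y\<rfloor> \<longleftrightarrow> real a \<le> sqrt y" using that by (simp add: le_nat_iff le_floor_iff)
    also have "\<dots> \<longleftrightarrow> (real a)\<^sup>2 \<le> y" using that abs_le_square_iff[of "real a" "sqrt y"] by simp
    finally show ?thesis .
  qed
  have S: "(a, b) \<in> ?S \<longleftrightarrow> 1 \<le> a \<and> (real a)\<^sup>2 + (real b)\<^sup>2 \<le> x" for a b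
  proof -
    \<comment> \<open>The condition on \<open>a\<close> must be kept: for a negative radicand the
      range of \<open>b\<close> would still contain 0.\<close>
    have "(a, b) \<in> ?S \<longleftrightarrow> 1 \<le> a \<and> (real a)\<^sup>2 \<le> x \<and> b \<le> nat \<lfloor>sqrt (x - (real a)\<^sup>2)\<rfloor>"
      using le_floor_sqrt[of x a] assms by auto
    also have "\<dots> \<longleftrightarrow> 1 \<le> a \<and> (real a)\<^sup>2 \<le> x \<and> (real b)\<^sup>2 \<le> x - (real a)\<^sup>2"
      using le_floor_sqrt[of "x - (real a)\<^sup>2" b] by auto
    also have "\<dots> \<longleftrightarrow> 1 \<le> a \<and> (real a)\<^sup>2 + (real b)\<^sup>2 \<le> x"
      using zero_le_power2[of "real b"] by (smt (verit))
    finally show ?thesis .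
  qed
  show "inj_on (\<lambda>(a, b). Complex (real a) (real b)) ?S" by (auto simp: inj_on_def)
  show "(\<lambda>(a, b). Complex (real a) (real b)) ` ?S = {z. grep z \<and> gnorm z \<le> x}"
  proof (intro equalityI subsetI)
    fix z assume "z \<in> (\<lambda>(a, b). Complex (real a) (real b)) ` ?S"
    then obtain a b where ab: "(a, b) \<in> ?S" "z = Complex (real a) (real b)" by auto
    have "1 \<le> a \<and> (real a)\<^sup>2 + (real b)\<^sup>2 \<le> x" using ab(1) S by blast
    then show "z \<in> {z. grep z \<and> gnorm z \<le> x}"
      unfolding ab(2) by (simp add: grep_def gint_def gnorm_def)
  next
    fix z assume "z \<in> {z. grep z \<and> gnorm z \<le> x}"
    then have z: "Re z \<in> \<int>" "Im z \<in> \<int>" "0 < Re z" "0 \<le> Im z" "(Re z)\<^sup>2 + (Im z)\<^sup>2 \<le> x"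
      by (auto simp: grep_def gint_def gnorm_def)
    then have "Re z \<in> \<nat>" "Im z \<in> \<nat>" by (auto simp: Nats_altdef2)
    then obtain a b where ab: "Re z = real a" "Im z = real b"
      by (auto elim!: Nats_cases)
    have "(a, b) \<in> ?S" unfolding S using z ab by auto
    moreover have "z = Complex (real a) (real b)" using ab by (simp add: complex_eq_iff)
    ultimately show "z \<in> (\<lambda>(a, b). Complex (real a) (real b)) ` ?S" by (auto intro!: image_eqI[of _ _ "(a, b)"])
  qed
qed

lemma finite_grep_norm_le: "finite {z. grep z \<and> gnorm z \<le> x}"
proof (cases "0 < x")
  case True
  show ?thesis using bij_betw_finite[OF grep_norm_le_bij[OF True]] by simp
next
  case False
  have "{z. grep z \<and> gnorm z \<le> x} = {}"
  proof (intro equals0I)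
    fix z assume "z \<in> {z. grep z \<and> gnorm z \<le> x}"
    then have "0 < Re z" "(Re z)\<^sup>2 + (Im z)\<^sup>2 \<le> 0" using False by (auto simp: grep_def gnorm_def)
    moreover from this have "0 < (Re z)\<^sup>2" by (intro zero_less_power)
    ultimately show False using zero_le_power2[of "Im z"] by linarith
  qed
  then show ?thesis by (metis finite.emptyI)
qed

text \<open>Column \<open>a\<close> holds a floor plus one points, between the height and the height
  plus one. Hence the count exceeds the sum of heights by at most n \<le> R, while that sum falls
  short of the area by at most R.\<close>

lemma card_grep_norm_le:
  assumes "0 < x"
  shows "\<bar>real (card {z. grep z \<and> gnorm z \<le> x}) - pi / 4 * x\<bar> \<le> 1 * sqrt x"
proof -
  define R where "R = sqrt x"
  define n where "n = nat \<lfloor>R\<rfloor>"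
  have R: "0 < R" "R\<^sup>2 = x" using assms by (simp_all add: R_def)
  have n: "real n \<le> R" "R < real n + 1" unfolding n_def using R by linarith+
  have "card {z. grep z \<and> gnorm z \<le> x} = card (SIGMA a:{1..n}. {..nat \<lfloor>sqrt (x - (real a)\<^sup>2)\<rfloor>})"
    using bij_betw_same_card[OF grep_norm_le_bij[OF assms]] by (simp add: n_def R_def)
  also have "\<dots> = (\<Sum>a=1..n. nat \<lfloor>sqrt (x - (real a)\<^sup>2)\<rfloor> + 1)" by simp
  finally have card: "real (card {z. grep z \<and> gnorm z \<le> x})
      = (\<Sum>a=1..n. real (nat \<lfloor>sqrt (x - (real a)\<^sup>2)\<rfloor>) + 1)" by (simp only: of_nat_sum of_nat_add of_nat_1)
  have fl: "sqrt (x - (real a)\<^sup>2) \<le> real (nat \<lfloor>sqrt (x - (real a)\<^sup>2)\<rfloor>) + 1"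
    "real (nat \<lfloor>sqrt (x - (real a)\<^sup>2)\<rfloor>) \<le> sqrt (x - (real a)\<^sup>2)" if "a \<in> {1..n}" for a
  proof -
    have "real a \<le> R" using that n by auto
    then have "(real a)\<^sup>2 \<le> R\<^sup>2" by (intro power_mono) auto
    then have "0 \<le> sqrt (x - (real a)\<^sup>2)" using R by simp
    then show "sqrt (x - (real a)\<^sup>2) \<le> real (nat \<lfloor>sqrt (x - (real a)\<^sup>2)\<rfloor>) + 1"
      "real (nat \<lfloor>sqrt (x - (real a)\<^sup>2)\<rfloor>) \<le> sqrt (x - (real a)\<^sup>2)" by linarith+
  qed
  define T where "T = (\<Sum>a=1..n. sqrt (x - (real a)\<^sup>2))"
  have "T \<le> real (card {z. grep z \<and> gnorm z \<le> x})"
    unfolding T_def card by (intro sum_mono fl)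
  moreover have "real (card {z. grep z \<and> gnorm z \<le> x}) \<le> (\<Sum>a=1..n. sqrt (x - (real a)\<^sup>2) + 1)"
    unfolding card using fl(2) by (intro sum_mono) auto
  then have "real (card {z. grep z \<and> gnorm z \<le> x}) \<le> T + real n" by (simp add: T_def sum.distrib)
  moreover have "\<bar>T - pi / 4 * x + R / 2\<bar> \<le> R / 2"
    using gauss_circle_quadrant[OF R(1) n] by (simp add: T_def R(2))
  ultimately show ?thesis using n unfolding R_def[symmetric] by linarith
qed

section \<open>The exponential divisor functions\<close>

text \<open>Induction with q = s^2: one factor s^a absorbs a new factor a + 1 by Bernoulli, the
  other comes from the induction hypothesis at s.\<close>

lemma polynomial_le_exponential:
  fixes q :: real
  assumes "1 < q"
  shows "\<exists>B. \<forall>a. (real a + 1) ^ j \<le> B * q ^ a"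
  using assms
proof (induction j arbitrary: q)
  case 0
  then show ?case by (intro exI[of _ 1]) (simp add: one_le_power)
next
  case (Suc j)
  define s where "s = sqrt q"
  have s: "1 < s" "s * s = q" using Suc.prems by (auto simp: s_def)
  obtain B where B: "\<And>a. (real a + 1) ^ j \<le> B * s ^ a" using Suc.IH[OF s(1)] by blast
  \<comment> \<open>The minimum with 1 makes d (a + 1) \<le> 1 + a (s - 1) hold, constant term
    included.\<close>
  define d where "d = min 1 (s - 1)"
  have d: "0 < d" "d \<le> 1" "d \<le> s - 1" using s by (auto simp: d_def)
  have "(real a + 1) ^ Suc j \<le> B / d * q ^ a" for a
  proof -
    have "d * (real a + 1) \<le> 1 + real a * (s - 1)"
      using d mult_left_mono[of d "s - 1" "real a"] by (simp add: algebra_simps)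
    also have "\<dots> \<le> (1 + (s - 1)) ^ a" using s by (intro Bernoulli_inequality) auto
    finally have "real a + 1 \<le> s ^ a / d" using d by (simp add: field_simps)
    then have "(real a + 1) * (real a + 1) ^ j \<le> (s ^ a / d) * (B * s ^ a)"
      using B[of a] d s by (intro mult_mono) auto
    also have "\<dots> = B / d * q ^ a" by (simp flip: s(2) add: power_mult_distrib)
    finally show ?thesis by simp
  qed
  then show ?case by blast
qed

lemma card_lists_le:
  assumes "finite A" "S \<subseteq> {xs. set xs \<subseteq> A \<and> length xs = k}"
  shows "card S \<le> card A ^ k"
  using card_mono[OF finite_lists_length_eq[OF assms(1)] assms(2)] assms(1)
  by (simp add: card_lists_length_eq)

lemma dvd_prod_list: "x \<in> set xs \<Longrightarrow> x dvd prod_list xs" for x :: "'a :: comm_monoid_mult"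
  by (induction xs) auto

text \<open>Choosing a 2-adic exponent \<open>e\<close> for each admissible factor turns a factorization of
  \<open>2 ^ n\<close> into a composition of \<open>n\<close>.\<close>

lemma card_factorizations_power_two_le:
  fixes w :: "'a \<Rightarrow> nat"
  assumes k: "k \<ge> 1"
    and S: "\<And>xs. xs \<in> S \<Longrightarrow> length xs = k \<and> set xs \<subseteq> E \<and> prod_list (map w xs) = 2 ^ n"
    and e: "\<And>x. x \<in> E \<Longrightarrow> w x = 2 ^ e x" and inj: "inj_on e E"
  shows "card S \<le> (n + k - 1) choose n"
proof -
  have sum: "prod_list (map w xs) = 2 ^ sum_list (map e xs)" if "set xs \<subseteq> E" for xs
    using that by (induction xs) (auto simp: e power_add)
  let ?L = "{l :: nat list. length l = k \<and> sum_list l = n}"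
  have card: "card ?L = (n + k - 1) choose n" by (rule card_length_sum_list)
  then have "card ?L > 0" using k by simp
  then have fin: "finite ?L" by (rule card_ge_0_finite)
  have inj': "inj_on (map e) S"
  proof (rule inj_onI)
    fix xs ys assume "xs \<in> S" "ys \<in> S" and eq: "map e xs = map e ys"
    have "inj_on e (set xs \<union> set ys)"
      using S[OF \<open>xs \<in> S\<close>] S[OF \<open>ys \<in> S\<close>] by (intro inj_on_subset[OF inj]) auto
    with eq show "xs = ys" by (rule map_inj_on)
  qed
  have sub: "map e ` S \<subseteq> ?L"
  proof safe
    fix xs assume xs: "xs \<in> S"
    show "length (map e xs) = k" using S[OF xs] by simp
    have "(2::nat) ^ sum_list (map e xs) = 2 ^ n" using S[OF xs] sum[of xs] by simp
    then show "sum_list (map e xs) = n" by simp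
  qed
  show ?thesis using card_inj_on_le[OF inj' sub fin] unfolding card .
qed

section \<open>Values and growth of the divisor function on the integers\<close>

lemma tau_1: "tau k 1 = 1"
proof -
  have "{xs :: nat list. length xs = k \<and> (\<forall>x\<in>set xs. x > 0) \<and> prod_list xs = 1} = {replicate k 1}"
  proof (intro equalityI subsetI)
    fix xs :: "nat list" assume xs: "xs \<in> {xs. length xs = k \<and> (\<forall>x\<in>set xs. x > 0) \<and> prod_list xs = 1}"
    then have "x = 1" if "x \<in> set xs" for x using dvd_prod_list[OF that] by simp
    then show "xs \<in> {replicate k 1}" using xs by (simp add: replicate_eqI)
  qed auto
  then show ?thesis by (simp add: tau_def)
qed

lemma tau_2_le: "k \<ge> 1 \<Longrightarrow> tau k 2 \<le> k"
proof -
  assume k: "k \<ge> 1"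
  have "tau k 2 \<le> (1 + k - 1) choose 1"
    unfolding tau_def
  proof (rule card_factorizations_power_two_le[OF k, where E = "{1, 2}" and w = id and e = "\<lambda>x. x - 1"])
    fix xs :: "nat list" assume xs: "xs \<in> {xs. length xs = k \<and> (\<forall>x\<in>set xs. x > 0) \<and> prod_list xs = 2}"
    have "x \<in> {1, 2}" if "x \<in> set xs" for x
      using dvd_imp_le[OF dvd_prod_list[OF that]] xs that by force
    then show "length xs = k \<and> set xs \<subseteq> {1, 2} \<and> prod_list (map id xs) = 2 ^ 1" using xs by auto
  qed auto
  then show ?thesis by simp
qed

text \<open>Every entry divides the positive product, leaving at most a + 1 choices for each of the
  \<open>k\<close> entries.\<close>

lemma tau_le: "real (tau k a) \<le> (real a + 1) ^ k"
proof -
  have "{xs :: nat list. length xs = k \<and> (\<forall>x\<in>set xs. x > 0) \<and> prod_list xs = a}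
      \<subseteq> {xs. set xs \<subseteq> {..a} \<and> length xs = k}"
  proof safe
    fix xs :: "nat list" and x
    assume "\<forall>x\<in>set xs. x > 0" "x \<in> set xs"
    moreover from this have "prod_list xs > 0" by (auto intro!: Nat.gr0I simp: prod_list_zero_iff)
    ultimately show "x \<le> prod_list xs" by (intro dvd_imp_le dvd_prod_list)
  qed
  then have "tau k a \<le> card {..a} ^ k" unfolding tau_def by (intro card_lists_le) auto
  then have "real (tau k a) \<le> real ((a + 1) ^ k)" by (simp only: card_atMost Suc_eq_plus1 of_nat_le_iff)
  then show ?thesis by (simp add: add.commute)
qed

section \<open>Values and growth of the Gaussian divisor function\<close>

definition gnat :: "complex \<Rightarrow> nat" where
  "gnat z = nat \<lfloor>gnorm z\<rfloor>"

lemma gnat: "gint z \<Longrightarrow> real (gnat z) = gnorm z"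
  using gnorm_nonneg[of z] gnorm_Ints[of z] by (auto simp: gnat_def elim!: Ints_cases)

lemma prod_list_gnat:
  assumes "\<forall>x\<in>set xs. grep x" "gassoc (prod_list xs) (of_nat a)"
  shows "prod_list (map gnat xs) = a\<^sup>2"
proof -
  have "real (prod_list (map gnat xs)) = gnorm (prod_list xs)"
    using assms(1) by (induction xs) (auto simp: gnorm_mult gnat gnorm_def[of 1])
  also obtain u where "gunit u" "prod_list xs = u * of_nat a" using assms(2) by (auto simp: gassoc_def)
  then have "gnorm (prod_list xs) = real (a\<^sup>2)"
    by (simp add: gnorm_mult gunit_def gnorm_def[of "of_nat a"])
  finally show ?thesis by (simp only: of_nat_eq_iff)
qed

text \<open>Because 2 ramifies, each of the norms 1, 2 and 4 has a single canonical representative.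
  This makes the exponent map in \<open>gtau_2_le\<close> injective.\<close>

lemma grep_gnat_cases:
  assumes "grep z"
  shows "gnat z = 1 \<longleftrightarrow> z = 1" "gnat z = 2 \<longleftrightarrow> z = Complex 1 1" "gnat z = 4 \<longleftrightarrow> z = 2"
proof -
  have "Re z \<in> \<int>" "Im z \<in> \<int>" using assms by (auto simp: grep_def gint_def)
  then obtain a b :: int where ab: "Re z = a" "Im z = b" by (auto elim!: Ints_cases)
  then have pos: "a \<ge> 1" "b \<ge> 0" using assms by (auto simp: grep_def)
  have "real_of_int (int (gnat z)) = real_of_int (a\<^sup>2 + b\<^sup>2)"
    using gnat[OF grep_gint[OF assms]] by (simp add: gnorm_def ab)
  then have n: "int (gnat z) = a\<^sup>2 + b\<^sup>2" by (simp only: of_int_eq_iff)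
  have small: "a \<le> 2" "b \<le> 2" if "a\<^sup>2 + b\<^sup>2 \<le> 4"
  proof -
    have "a\<^sup>2 \<le> 4" "b\<^sup>2 \<le> 4" using that zero_le_power2[of a] zero_le_power2[of b] by linarith+
    then show "a \<le> 2" "b \<le> 2" using abs_le_square_iff[of a 2] abs_le_square_iff[of b 2] by auto
  qed
  have cases: "(a = 1 \<or> a = 2) \<and> (b = 0 \<or> b = 1 \<or> b = 2)" if "gnat z \<le> 4"
    using small pos n that by auto
  show "gnat z = 1 \<longleftrightarrow> z = 1" "gnat z = 2 \<longleftrightarrow> z = Complex 1 1" "gnat z = 4 \<longleftrightarrow> z = 2"
    using cases n ab by (auto simp: complex_eq_iff)
qed

lemma gtau_1: "gtau k 1 = 1"
proof -
  have "{xs :: complex list. length xs = k \<and> (\<forall>x\<in>set xs. grep x) \<and> gassoc (prod_list xs) (of_nat 1)}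
      = {replicate k 1}"
  proof (intro equalityI subsetI)
    fix xs :: "complex list"
    assume xs: "xs \<in> {xs. length xs = k \<and> (\<forall>x\<in>set xs. grep x) \<and> gassoc (prod_list xs) (of_nat 1)}"
    have "x = 1" if "x \<in> set xs" for x
    proof -
      have "gnat x dvd prod_list (map gnat xs)" using that by (intro dvd_prod_list) auto
      then have "gnat x = 1" using xs prod_list_gnat[of xs 1] by simp
      then show ?thesis using grep_gnat_cases(1)[of x] xs that by auto
    qed
    then show "xs \<in> {replicate k 1}" using xs by (simp add: replicate_eqI)
  qed (auto simp: gassoc_def intro!: exI[of _ 1])
  then show ?thesis by (simp add: gtau_def)
qed

lemma dvd_4_cases: "n dvd 4 \<Longrightarrow> n = 1 \<or> n = 2 \<or> n = 4" for n :: nat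
proof -
  assume "n dvd 4"
  moreover from this have "n \<le> 4" by (intro dvd_imp_le) auto
  ultimately show ?thesis by (cases "n = 0"; cases "n = 3") auto
qed

text \<open>Taking norms, a factorization of 2 becomes one of 4 = 2^2, with factors of norm 1, 2 or
  4. The exponents form a composition of 2 into \<open>k\<close> nonnegative parts.\<close>

lemma gtau_2_le: "k \<ge> 1 \<Longrightarrow> gtau k 2 \<le> (k + 1) choose 2"
proof -
  assume k: "k \<ge> 1"
  let ?E = "{z. grep z \<and> gnat z \<in> {1, 2, 4}}"
  let ?e = "\<lambda>z. if gnat z = 1 then 0 else if gnat z = 2 then 1 else (2::nat)"
  have "gtau k 2 \<le> (2 + k - 1) choose 2"
    unfolding gtau_def
  proof (rule card_factorizations_power_two_le[OF k, where E = ?E and w = gnat and e = ?e])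
    fix xs :: "complex list"
    assume xs: "xs \<in> {xs. length xs = k \<and> (\<forall>x\<in>set xs. grep x) \<and> gassoc (prod_list xs) (of_nat 2)}"
    then have p: "prod_list (map gnat xs) = 4" using prod_list_gnat[of xs 2] by simp
    have "x \<in> ?E" if "x \<in> set xs" for x
    proof -
      have "gnat x dvd 4" unfolding p[symmetric] using that by (intro dvd_prod_list) auto
      then show ?thesis using dvd_4_cases[of "gnat x"] xs that by simp
    qed
    then show "length xs = k \<and> set xs \<subseteq> ?E \<and> prod_list (map gnat xs) = 2 ^ 2" using xs p by auto
  next
    show "inj_on ?e ?E"
    proof (rule inj_onI)
      fix x y assume x: "x \<in> ?E" and y: "y \<in> ?E" and eq: "?e x = ?e y"
      from x y have g: "grep x" "grep y" by simp_all
      from x y have "gnat x = 1 \<or> gnat x = 2 \<or> gnat x = 4" "gnat y = 1 \<or> gnat y = 2 \<or> gnat y = 4" by simp_all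
      moreover from this have "gnat x = gnat y" using eq by (elim disjE) simp_all
      ultimately show "x = y"
        using grep_gnat_cases[OF g(1)] grep_gnat_cases[OF g(2)] by metis
    qed
  qed auto
  then show ?thesis by (simp add: add.commute)
qed

text \<open>Entries have norm at most a^2, and the lattice point count bounds the choices for each
  by 2 (a + 1)^2. For a = 0 no list exists, canonical elements being nonzero.\<close>

lemma gtau_le: "real (gtau k a) \<le> 2 ^ k * (real a + 1) ^ (2 * k)"
proof (cases "a = 0")
  case True
  have "{xs :: complex list. length xs = k \<and> (\<forall>x\<in>set xs. grep x) \<and> gassoc (prod_list xs) (of_nat 0)} = {}"
  proof (intro equals0I)
    fix xs :: "complex list"
    assume "xs \<in> {xs. length xs = k \<and> (\<forall>x\<in>set xs. grep x) \<and> gassoc (prod_list xs) (of_nat 0)}"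
    then have "prod_list xs = 0" "\<forall>x\<in>set xs. x \<noteq> 0" using grep_nonzero by (auto simp: gassoc_def)
    then show False by (auto simp: prod_list_zero_iff)
  qed
  then have "gtau k a = 0" unfolding gtau_def True by (simp only: card.empty)
  then show ?thesis by simp
next
  case False
  let ?A = "{z. grep z \<and> gnorm z \<le> (real a)\<^sup>2}"
  have "{xs. length xs = k \<and> (\<forall>x\<in>set xs. grep x) \<and> gassoc (prod_list xs) (of_nat a)}
      \<subseteq> {xs. set xs \<subseteq> ?A \<and> length xs = k}"
  proof safe
    fix xs x assume xs: "\<forall>x\<in>set xs. grep x" "gassoc (prod_list xs) (of_nat a)" and x: "x \<in> set xs"
    have "gnat x dvd a\<^sup>2"
      unfolding prod_list_gnat[OF xs, symmetric] using x by (intro dvd_prod_list) auto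
    then have "gnat x \<le> a\<^sup>2" using False by (intro dvd_imp_le) auto
    then have "real (gnat x) \<le> real (a\<^sup>2)" by (simp only: of_nat_le_iff)
    then show "gnorm x \<le> (real a)\<^sup>2" using gnat[OF grep_gint[of x]] xs(1) x by auto
  qed auto
  then have "gtau k a \<le> card ?A ^ k"
    unfolding gtau_def by (intro card_lists_le finite_grep_norm_le)
  then have "real (gtau k a) \<le> real (card ?A) ^ k" by (simp only: of_nat_le_iff flip: of_nat_power)
  also have "\<dots> \<le> (2 * (real a + 1) ^ 2) ^ k"
  proof (intro power_mono)
    have "\<bar>real (card ?A) - pi / 4 * (real a)\<^sup>2\<bar> \<le> 1 * sqrt ((real a)\<^sup>2)"
      using False by (intro card_grep_norm_le) auto
    then have "real (card ?A) \<le> pi / 4 * (real a)\<^sup>2 + real a" by simp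
    also have "pi / 4 * (real a)\<^sup>2 \<le> 1 * (real a)\<^sup>2"
      using pi_less_4 by (intro mult_right_mono) auto
    also have "1 * (real a)\<^sup>2 + real a \<le> 2 * (real a + 1) ^ 2" by (simp add: power2_eq_square algebra_simps)
    finally show "real (card ?A) \<le> 2 * (real a + 1) ^ 2" by simp
  qed auto
  also have "\<dots> = 2 ^ k * (real a + 1) ^ (2 * k)" by (simp add: power_mult_distrib power_mult)
  finally show ?thesis .
qed

section \<open>Application to the Gaussian primes\<close>

lemma gprime_gnorm_ge_2:
  assumes "p \<in> gprimes"
  shows "2 \<le> gnorm p"
proof -
  obtain n where n: "gnorm p = of_int n" using gnorm_Ints[OF gprimesD(3)[OF assms]] by (elim Ints_cases)
  have "1 \<le> gnorm p" by (rule gnorm_ge_1[OF gprimesD(3,4)[OF assms]])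
  moreover have "gnorm p \<noteq> 1" using gprimesD(3,5)[OF assms] by (simp add: gunit_def)
  ultimately show ?thesis by (simp add: n)
qed

interpretation gaussian: beurling gprimes gnorm "pi / 4" 1
proof
  show "2 \<le> gnorm p" if "p \<in> gprimes" for p using that by (rule gprime_gnorm_ge_2)
  show "finite {M. set_mset M \<subseteq> gprimes \<and> mnorm gnorm M \<le> x}" for x
    using bij_betw_finite[OF bij_betw_gprime_factorization] finite_grep_norm_le by blast
  show "\<bar>real (card {M. set_mset M \<subseteq> gprimes \<and> mnorm gnorm M \<le> x}) - pi / 4 * x\<bar> \<le> 1 * sqrt x"
    if "0 < x" for x
    unfolding bij_betw_same_card[OF bij_betw_gprime_factorization] using that by (rule card_grep_norm_le)
qed

lemma gsum_asymptotics:
  fixes t :: "nat \<Rightarrow> nat"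
  assumes t1: "t 1 = 1" and t2: "\<bar>real (t 2) - 1\<bar> \<le> real m" and r: "real m \<le> r"
    and growth: "\<And>a. real (t a) \<le> b * (real a + 1) ^ j"
    and f: "\<And>\<alpha>. f \<alpha> = (\<Prod>p\<in>{p. grep p \<and> gprime p \<and> gdvd p \<alpha>}. t (gmult p \<alpha>))"
  shows "\<exists>P. (euler_partial t \<longlongrightarrow> P) at_top \<and>
    (\<lambda>x. gsum f x - pi / 4 * P * x) \<in> O(\<lambda>x. sqrt x * ln x powr r)"
proof -
  obtain B where B: "\<And>a. (real a + 1) ^ j \<le> B * (6/5) ^ a"
    using polynomial_le_exponential[of "6/5" j] by auto
  \<comment> \<open>At least 1 because g 0 = 1 must obey the growth bound.\<close>
  define B' where "B' = max 1 (b * B)"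
  \<comment> \<open>The value at exponent 0 is reset to 1, as multiplicativity demands;
    \<open>t 0\<close> never enters the sums, since exponents in the support are positive. The
    differences \<open>g\<close> then invert the partial sums.\<close>
  define T where "T a = (if a = 0 then 1 else real (t a))" for a
  define g where "g a = (case a of 0 \<Rightarrow> 1 | Suc a' \<Rightarrow> T (Suc a') - T a')" for a
  have b: "b \<ge> 0" using growth[of 0] by (simp add: order_trans[OF of_nat_0_le_iff])
  have T: "0 \<le> T a" "T a \<le> B' * (6/5) ^ a" for a
  proof -
    show "0 \<le> T a" by (simp add: T_def)
    have "real (t a) \<le> b * (B * (6/5) ^ a)"
      using growth[of a] mult_left_mono[OF B b, of a] by linarith
    also have "\<dots> \<le> B' * (6/5) ^ a"
      unfolding mult.assoc[symmetric] by (intro mult_right_mono) (auto simp: B'_def)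
    finally show "T a \<le> B' * (6/5) ^ a" by (simp add: T_def B'_def)
  qed
  interpret beurling_mult gprimes gnorm "pi / 4" 1 g m B'
  proof
    show "g 0 = 1" "g (Suc 0) = 0" using t1 by (simp_all add: g_def T_def)
    show "\<bar>g 2\<bar> \<le> real m" using t1 t2 by (simp add: g_def T_def numeral_2_eq_2)
    show "\<bar>g a\<bar> \<le> B' * (6/5) ^ a" for a
    proof (cases a)
      case 0
      then show ?thesis by (simp add: g_def B'_def)
    next
      case (Suc i)
      have "T i \<le> B' * (6/5) ^ a"
        using T(2)[of i] by (rule order_trans) (auto simp: Suc B'_def intro!: mult_left_mono)
      moreover have "g a = T a - T i" by (simp add: g_def Suc)
      ultimately show ?thesis using T(1)[of i] T[of a] by linarith
    qed
  qed
  have partial: "(\<Sum>a\<le>n. g a) = T n" for n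
    by (induction n) (simp_all add: g_def T_def)
  have "euler_partial t = (\<lambda>y. \<Prod>p | p \<in> gprimes \<and> gnorm p \<le> y. 1 + (\<Sum>a. g (a + 2) / gnorm p ^ (a + 2)))"
    by (simp add: fun_eq_iff euler_partial_def euler_fac_def gprimes_def g_def T_def numeral_2_eq_2 conj_assoc)
  moreover have "gsum f x = (\<Sum>M | set_mset M \<subseteq> gprimes \<and> mnorm gnorm M \<le> x. mfun T M)" for x
    unfolding gsum_eq_sum_mfun[of f, OF f] by (intro sum.cong refl) (auto simp: mfun_def T_def not_in_iff[symmetric] intro!: prod.cong)
  moreover have "T 0 = 1" by (simp add: T_def)
  ultimately show ?thesis
    using euler_product_tendsto sum_mfun_asymptotics[OF _ partial r] by auto
qed

theorem theorem4:
  fixes k :: nat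
  assumes "k \<ge> 2"
  shows "(\<exists>P. (euler_partial (tau k) \<longlongrightarrow> P) at_top \<and>
           (\<lambda>x. gsum (tE k) x - pi / 4 * P * x)
             \<in> O(\<lambda>x. sqrt x * ln x powr (3 + 4 * (real k - 1) / 3))) \<and>
         (\<exists>P. (euler_partial (gtau k) \<longlongrightarrow> P) at_top \<and>
           (\<lambda>x. gsum (tEs k) x - pi / 4 * P * x)
             \<in> O(\<lambda>x. sqrt x * ln x powr (3 + 2 * (real k ^ 2 + real k - 2) / 3)))"
proof (intro conjI)
  have k: "2 \<le> real k" using assms by simp
  show "\<exists>P. (euler_partial (tau k) \<longlongrightarrow> P) at_top \<and>
           (\<lambda>x. gsum (tE k) x - pi / 4 * P * x)
             \<in> O(\<lambda>x. sqrt x * ln x powr (3 + 4 * (real k - 1) / 3))"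
  proof (rule gsum_asymptotics[where m = "k - 1" and b = 1 and j = k])
    \<comment> \<open>Only an upper bound for \<open>tau k 2\<close> is at hand; k \<ge> 2 gives k -
      1 \<ge> 1, which covers the lower side.\<close>
    show "\<bar>real (tau k 2) - 1\<bar> \<le> real (k - 1)" using tau_2_le[of k] assms by auto
    show "real (k - 1) \<le> 3 + 4 * (real k - 1) / 3" using assms k by (simp add: of_nat_diff field_simps)
  qed (simp_all add: tau_1[unfolded One_nat_def] tau_le tE_def)
next
  define c where "c = (k + 1) choose 2"
  have c: "real c = (real k ^ 2 + real k) / 2"
  proof -
    have "even ((k + 1) * k)" by simp
    then have "real ((k + 1) * k div 2) = real ((k + 1) * k) / 2"
      using real_of_nat_div[of 2 "(k + 1) * k"] by simp
    then show ?thesis by (simp add: c_def choose_two power2_eq_square algebra_simps)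
  qed
  have "2 * 2 \<le> real k * real k" using assms by (intro mult_mono) auto
  \<comment> \<open>Ensures that c - 1 is a genuine subtraction and at least 1, so the absolute
    value below needs only the upper bound for \<open>gtau k 2\<close>.\<close>
  then have c3: "3 \<le> real c" using assms by (simp add: c power2_eq_square)
  show "\<exists>P. (euler_partial (gtau k) \<longlongrightarrow> P) at_top \<and>
           (\<lambda>x. gsum (tEs k) x - pi / 4 * P * x)
             \<in> O(\<lambda>x. sqrt x * ln x powr (3 + 2 * (real k ^ 2 + real k - 2) / 3))"
  proof (rule gsum_asymptotics[where m = "c - 1" and b = "2 ^ k" and j = "2 * k"])
    have "gtau k 2 \<le> c" using gtau_2_le[of k] assms by (simp add: c_def)
    then show "\<bar>real (gtau k 2) - 1\<bar> \<le> real (c - 1)" using c3 by auto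
    have "real (c - 1) = (real k ^ 2 + real k - 2) / 2" using c c3 by (simp add: of_nat_diff field_simps)
    then show "real (c - 1) \<le> 3 + 2 * (real k ^ 2 + real k - 2) / 3" using c3 c by (simp add: field_simps)
  qed (simp_all add: gtau_1[unfolded One_nat_def] gtau_le tEs_def)
qed

end
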